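(* Let $(A,b)$ be a linear system over $\mathbb{Z}_d$ with associated simplicial complex $\Sigma$. Let $X=\bar N(\mathbb{Z}_d,\Sigma)$ and let $\gamma:X_2\to\mathbb{Z}_d$ be a $2$-cocycle whose cohomology class in $H^2(X,\mathbb{Z}_d)$ equals that of $\gamma_b$. Then there is an isomorphism between the solution groups $$\Gamma(A,b)\to\Gamma(A_X,b_\gamma).$$
   Context: Let $d>1$ be an integer. A linear system $(A,b)$ over $\mathbb{Z}_d$ consists of an $r\times c$ matrix $A$ over $\mathbb{Z}_d$ and $b\in\mathbb{Z}_d^r$. (The same definitions are used with arbitrary row and column index sets, each row having finitely many nonzero entries.) Its simplicial complex $\Sigma$ has vertices $\Sigma_0=\{v_1,\dots,v_c\}$ and is generated by $\sigma_i=\{v_j:A_{ij}\ne0\}$ (simplices are the singletons and the subsets of the $\sigma_i$; the empty set is allowed as a support). The row $A_i$ is regarded as a function $\Sigma_0\to\mathbb{Z}_d$, $A_i(v_j)=A_{ij}$. Standing assumptions on $(A,b)$: each $\langle A_i\rangle\subset\mathbb{Z}_d^{\Sigma_0}$ is isomorphic to $\mathbb{Z}_d$, and $\langle A_i\rangle\neq\langle A_j\rangle$ for distinct rows, with $\langle A_i\rangle\cap\langle A_j\rangle=0$ for $i\ne j$ (so that the union of the nerves $N\langle A_i\rangle$ is a wedge $\bigvee_{i=1}^rN\langle A_i\rangle$). The solution group $\Gamma(A,b)$ is the group generated by $J$ and $e_v$, $v\in\Sigma_0$, with relations: $J^d=e_v^d=1$ for all $v$; for every $\sigma\in\Sigma$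 the elements $\{J\}\cup\{e_v:v\in\sigma\}$ pairwise commute; $\prod_{v_j\in\sigma_i}e_{v_j}^{A_{ij}}=J^{b_i}$ for all $i$. For a group $H$, $NH$ is its nerve, $(NH)_n=H^n$. $N(\mathbb{Z}_d,\Sigma)\subset N(\mathbb{Z}_d^{\Sigma_0})$ has as $n$-simplices the tuples $(s_1,\dots,s_n)$ of functions $s_i:\Sigma_0\to\mathbb{Z}_d$ with $\bigcup_i\mathrm{supp}(s_i)\in\Sigma$. $\bar N(\mathbb{Z}_d,\Sigma)$ is the quotient simplicial set of $N(\mathbb{Z}_d,\Sigma)$ obtained by collapsing $\bigvee_{i=1}^rN\langle A_i\rangle$ to a point; thus $\bar N(\mathbb{Z}_d,\Sigma)_n=\{\bar0\}\sqcup\big(N(\mathbb{Z}_d,\Sigma)_n-(\bigvee_{i=1}^rN\langle A_i\rangle)_n\big)$. Cohomology is ordinary simplicial cohomology with $\mathbb{Z}_d$ coefficients. Let $\tilde b:N(\mathbb{Z}_d,\Sigma)_1\to\mathbb{Z}_d$ be the $1$-cochain with $\tilde b(aA_i)=ab_i$ for $a\in\mathbb{Z}_d$, and $\tilde b(s)=0$ if $s$ is not of the form $aA_i$. Then $\gamma_b$ is the $2$-cocycle on $\bar N(\mathbb{Z}_d,\Sigma)$ given by the coboundary of $\tilde b$: $\gamma_b(\bar s_1,\bar s_2)=\tilde b(s_1)+\tilde b(s_2)-\tilde b(s_1+s_2)$. For a simplicial set $X$ and a $2$-cochain $\gamma:X_2\to\mathbb{Z}_d$, the linear system $(A_X,b_\gamma)$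 has rows indexed by $X_2$ and columns indexed by $X_1$, with entries $(A_X)_{\sigma,x}=\sum_{0\le i\le2,\ d_i\sigma=x}(-1)^i$ (zero if $x$ is not a face of $\sigma$) and $(b_\gamma)_\sigma=-\gamma(\sigma)$. *)

theory Defs
  imports "HOL-Algebra.Product_Groups"
begin

section \<open>Groups given by generators and relations\<close>

text \<open>Words in the generators and their formal inverses; the letter \<open>(g, True)\<close> stands for
  \<open>g\<close> and \<open>(g, False)\<close> for the inverse of \<open>g\<close>. A relation \<open>u = v\<close> is the pair \<open>(u, v)\<close>.\<close>

type_synonym 'g word = "('g \<times> bool) list"

abbreviation words :: "'g set \<Rightarrow> 'g word set"
  where "words S \<equiv> lists (S \<times> UNIV)"

inductive_set pres_rel :: "'g set \<Rightarrow> ('g word \<times> 'g word) set \<Rightarrow> ('g word \<times> 'g word) set"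
  for S Rel
  where
    refl: "u \<in> words S \<Longrightarrow> (u, u) \<in> pres_rel S Rel"
  | sym: "(u, v) \<in> pres_rel S Rel \<Longrightarrow> (v, u) \<in> pres_rel S Rel"
  | trans: "(u, v) \<in> pres_rel S Rel \<Longrightarrow> (v, w) \<in> pres_rel S Rel \<Longrightarrow> (u, w) \<in> pres_rel S Rel"
  | append: "(u, v) \<in> pres_rel S Rel \<Longrightarrow> (u', v') \<in> pres_rel S Rel
      \<Longrightarrow> (u @ u', v @ v') \<in> pres_rel S Rel"
  | cancel: "g \<in> S \<Longrightarrow> ([(g, p), (g, \<not> p)], []) \<in> pres_rel S Rel"
  | relation: "(u, v) \<in> Rel \<Longrightarrow> u \<in> words S \<Longrightarrow> v \<in> words S \<Longrightarrow> (u, v) \<in> pres_rel S Rel"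

definition presented_group :: "'g set \<Rightarrow> ('g word \<times> 'g word) set \<Rightarrow> 'g word set monoid"
  where "presented_group S Rel =
    \<lparr>carrier = words S // pres_rel S Rel,
     monoid.mult = (\<lambda>U V. \<Union>u\<in>U. \<Union>v\<in>V. pres_rel S Rel `` {u @ v}),
     one = pres_rel S Rel `` {[]}\<rparr>"

lemma pres_rel_words:
  "(u, v) \<in> pres_rel S Rel \<Longrightarrow> u \<in> words S \<and> v \<in> words S"
  by (induction rule: pres_rel.induct) auto

lemma equiv_pres_rel: "equiv (words S) (pres_rel S Rel)"
proof (rule equivI)
  show "pres_rel S Rel \<subseteq> words S \<times> words S"
    using pres_rel_words by fast
  show "refl_on (words S) (pres_rel S Rel)"
    by (auto simp: refl_on_def intro: pres_rel.refl)
  show "Relation.sym (pres_rel S Rel)"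
    by (auto intro!: symI intro: pres_rel.sym)
  show "Relation.trans (pres_rel S Rel)"
    by (auto intro!: transI intro: pres_rel.trans)
qed

lemma presented_group_mult:
  assumes "u \<in> words S" "v \<in> words S"
  shows "(pres_rel S Rel `` {u}) \<otimes>\<^bsub>presented_group S Rel\<^esub> (pres_rel S Rel `` {v})
    = pres_rel S Rel `` {u @ v}"
proof -
  have "(\<lambda>u v. pres_rel S Rel `` {u @ v}) respects2 (pres_rel S Rel)"
    by (auto simp: congruent2_def
        intro!: equiv_class_eq [OF equiv_pres_rel] pres_rel.append)
  from UN_equiv_class2 [OF equiv_pres_rel equiv_pres_rel this assms]
  show ?thesis by (simp add: presented_group_def)
qed

lemma pres_rel_inverse:
  "u \<in> words S \<Longrightarrow> (rev (map (\<lambda>(g, p). (g, \<not> p)) u) @ u, []) \<in> pres_rel S Rel"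
proof (induction u)
  case Nil
  show ?case by (simp add: pres_rel.refl)
next
  case (Cons a u)
  obtain g p where a: "a = (g, p)" by (cases a)
  let ?v = "rev (map (\<lambda>(g, p). (g, \<not> p)) u)"
  from Cons a have g: "g \<in> S" and u: "u \<in> words S" by auto
  have v: "?v \<in> words S" using u by (auto simp: in_lists_conv_set)
  have "([(g, \<not> p), (g, \<not> \<not> p)] @ u, [] @ u) \<in> pres_rel S Rel"
    by (intro pres_rel.append pres_rel.cancel g pres_rel.refl u)
  then have "(?v @ [(g, \<not> p), (g, \<not> \<not> p)] @ u, ?v @ [] @ u) \<in> pres_rel S Rel"
    by (intro pres_rel.append [OF pres_rel.refl [OF v]])
  then show ?case
    using Cons.IH [OF u] by (auto simp: a intro: pres_rel.trans)
qed

lemma group_presented_group: "group (presented_group S Rel)"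
proof (rule groupI)
  fix x y assume "x \<in> carrier (presented_group S Rel)" "y \<in> carrier (presented_group S Rel)"
  then obtain u v where "u \<in> words S" "v \<in> words S"
    "x = pres_rel S Rel `` {u}" "y = pres_rel S Rel `` {v}"
    by (auto simp: presented_group_def elim!: quotientE)
  then show "x \<otimes>\<^bsub>presented_group S Rel\<^esub> y \<in> carrier (presented_group S Rel)"
    by (simp only: presented_group_mult) (simp add: presented_group_def quotientI)
next
  show "\<one>\<^bsub>presented_group S Rel\<^esub> \<in> carrier (presented_group S Rel)"
    by (simp add: presented_group_def quotientI)
next
  fix x y z assume "x \<in> carrier (presented_group S Rel)"
    "y \<in> carrier (presented_group S Rel)" "z \<in> carrier (presented_group S Rel)"
  then obtain u v w where "u \<in> words S" "v \<in> words S" "w \<in> words S"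
    "x = pres_rel S Rel `` {u}" "y = pres_rel S Rel `` {v}" "z = pres_rel S Rel `` {w}"
    by (auto simp: presented_group_def elim!: quotientE)
  then show "x \<otimes>\<^bsub>presented_group S Rel\<^esub> y \<otimes>\<^bsub>presented_group S Rel\<^esub> z =
      x \<otimes>\<^bsub>presented_group S Rel\<^esub> (y \<otimes>\<^bsub>presented_group S Rel\<^esub> z)"
    by (simp add: presented_group_mult)
next
  fix x assume "x \<in> carrier (presented_group S Rel)"
  then obtain u where u: "u \<in> words S" "x = pres_rel S Rel `` {u}"
    by (auto simp: presented_group_def elim!: quotientE)
  have one: "\<one>\<^bsub>presented_group S Rel\<^esub> = pres_rel S Rel `` {[]}"
    by (simp add: presented_group_def)
  show "\<one>\<^bsub>presented_group S Rel\<^esub> \<otimes>\<^bsub>presented_group S Rel\<^esub> x = x"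
    using u by (simp add: one presented_group_mult)
  let ?v = "rev (map (\<lambda>(g, p). (g, \<not> p)) u)"
  have v: "?v \<in> words S" using u by (auto simp: in_lists_conv_set)
  have "pres_rel S Rel `` {?v} \<otimes>\<^bsub>presented_group S Rel\<^esub> x = \<one>\<^bsub>presented_group S Rel\<^esub>"
    unfolding u(2) presented_group_mult [OF v u(1)] one
    by (rule equiv_class_eq [OF equiv_pres_rel pres_rel_inverse [OF u(1)]])
  moreover have "pres_rel S Rel `` {?v} \<in> carrier (presented_group S Rel)"
    using v by (simp add: presented_group_def quotientI)
  ultimately show "\<exists>y\<in>carrier (presented_group S Rel).
      y \<otimes>\<^bsub>presented_group S Rel\<^esub> x = \<one>\<^bsub>presented_group S Rel\<^esub>"
    by blast
qed

section \<open>Linear systems and solution groups\<close>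

text \<open>The group \<open>\<int>\<^sub>d\<close> is \<^const>\<open>integer_mod_group\<close>, with carrier \<open>{0..<int d}\<close> for \<open>d > 0\<close>.\<close>

record ('r, 'c) lin_sys =
  rows :: "'r set"
  cols :: "'c set"
  mat :: "'r \<Rightarrow> 'c \<Rightarrow> int"
  rhs :: "'r \<Rightarrow> int"

definition row_supp :: "('r, 'c) lin_sys \<Rightarrow> 'r \<Rightarrow> 'c set"
  where "row_supp L i = {v \<in> cols L. mat L i v \<noteq> 0}"

definition linear_system :: "nat \<Rightarrow> ('r, 'c) lin_sys \<Rightarrow> bool"
  where "linear_system d L \<longleftrightarrow>
    (\<forall>i\<in>rows L. (\<forall>v\<in>cols L. mat L i v \<in> carrier (integer_mod_group d))
      \<and> rhs L i \<in> carrier (integer_mod_group d) \<and> finite (row_supp L i))"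

definition complex_of :: "('r, 'c) lin_sys \<Rightarrow> 'c set set"
  where "complex_of L =
    {{}} \<union> {{v} | v. v \<in> cols L} \<union> {\<tau>. \<exists>i\<in>rows L. \<tau> \<subseteq> row_supp L i}"

datatype 'c sol_gen = J | E 'c

abbreviation gen_power :: "'g \<Rightarrow> int \<Rightarrow> 'g word"
  where "gen_power g k \<equiv> replicate (nat k) (g, True)"

text \<open>The product in the relation of a row is over an unordered set; since its factors commute by
  the other relations, the relation is imposed for every enumeration \<open>vs\<close> of the support.\<close>

definition solution_relations ::
    "nat \<Rightarrow> ('r, 'c) lin_sys \<Rightarrow> ('c sol_gen word \<times> 'c sol_gen word) set"
  where "solution_relations d L =
    {(gen_power J (int d), [])}
    \<union> {(gen_power (E v) (int d), []) | v. v \<in> cols L}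
    \<union> {([(g, True), (h, True)], [(h, True), (g, True)]) | g h.
         \<exists>\<sigma>\<in>complex_of L. g \<in> insert J (E ` \<sigma>) \<and> h \<in> insert J (E ` \<sigma>)}
    \<union> {(concat (map (\<lambda>v. gen_power (E v) (mat L i v)) vs), gen_power J (rhs L i)) | i vs.
         i \<in> rows L \<and> distinct vs \<and> set vs = row_supp L i}"

definition solution_group :: "nat \<Rightarrow> ('r, 'c) lin_sys \<Rightarrow> 'c sol_gen word set monoid"
  where "solution_group d L =
    presented_group (insert J (E ` cols L)) (solution_relations d L)"

section \<open>Simplicial sets\<close>

record 'a sset =
  simp :: "nat \<Rightarrow> 'a set"
  face :: "nat \<Rightarrow> nat \<Rightarrow> 'a \<Rightarrow> 'a"  \<comment> \<open>\<open>face X n i\<close> is \<open>d\<^sub>i\<close> on \<open>n\<close>-simplices\<close>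
  degen :: "nat \<Rightarrow> nat \<Rightarrow> 'a \<Rightarrow> 'a"  \<comment> \<open>\<open>degen X n i\<close> is \<open>s\<^sub>i\<close> on \<open>n\<close>-simplices\<close>

definition simplicial_set :: "'a sset \<Rightarrow> bool"
  where "simplicial_set X \<longleftrightarrow>
    (\<forall>n. \<forall>x\<in>simp X (Suc n). \<forall>i\<le>Suc n. face X (Suc n) i x \<in> simp X n) \<and>
    (\<forall>n. \<forall>x\<in>simp X n. \<forall>i\<le>n. degen X n i x \<in> simp X (Suc n)) \<and>
    (\<forall>n. \<forall>x\<in>simp X (Suc (Suc n)). \<forall>i j. i < j \<longrightarrow> j \<le> Suc (Suc n) \<longrightarrow>
       face X (Suc n) i (face X (Suc (Suc n)) j x)
         = face X (Suc n) (j - 1) (face X (Suc (Suc n)) i x)) \<and>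
    (\<forall>n. \<forall>x\<in>simp X n. \<forall>i j. i \<le> j \<longrightarrow> j \<le> n \<longrightarrow>
       degen X (Suc n) i (degen X n j x) = degen X (Suc n) (Suc j) (degen X n i x)) \<and>
    (\<forall>n. \<forall>x\<in>simp X n. \<forall>j\<le>n. face X (Suc n) j (degen X n j x) = x
       \<and> face X (Suc n) (Suc j) (degen X n j x) = x) \<and>
    (\<forall>n. \<forall>x\<in>simp X (Suc n). \<forall>i j. i < j \<longrightarrow> j \<le> Suc n \<longrightarrow>
       face X (Suc (Suc n)) i (degen X (Suc n) j x)
         = degen X n (j - 1) (face X (Suc n) i x)) \<and>
    (\<forall>n. \<forall>x\<in>simp X (Suc n). \<forall>i j. Suc j < i \<longrightarrow> i \<le> Suc (Suc n) \<longrightarrow>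
       face X (Suc (Suc n)) i (degen X (Suc n) j x)
         = degen X n j (face X (Suc n) (i - 1) x))"

definition nerve :: "('a, 'm) monoid_scheme \<Rightarrow> 'a list sset"
  where "nerve G =
    \<lparr>simp = (\<lambda>n. {xs. length xs = n \<and> set xs \<subseteq> carrier G}),
     face = (\<lambda>n i xs. map (\<lambda>k. if Suc k < i then xs ! k
        else if Suc k = i then xs ! k \<otimes>\<^bsub>G\<^esub> xs ! Suc k else xs ! Suc k) [0..<n - 1]),
     degen = (\<lambda>n i xs. map (\<lambda>k. if k < i then xs ! k
        else if k = i then \<one>\<^bsub>G\<^esub> else xs ! (k - 1)) [0..<Suc n])\<rparr>"

text \<open>The quotient of \<open>X\<close> by a nonempty simplicial subset \<open>Y\<close>; \<open>None\<close> is the collapsed point.\<close>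

definition collapse_map :: "'b sset \<Rightarrow> nat \<Rightarrow> 'b \<Rightarrow> 'b option"
  where "collapse_map Y n x = (if x \<in> simp Y n then None else Some x)"

definition collapse :: "'a sset \<Rightarrow> 'a sset \<Rightarrow> 'a option sset"
  where "collapse X Y =
    \<lparr>simp = (\<lambda>n. insert None (Some ` (simp X n - simp Y n))),
     face = (\<lambda>n i x. case x of None \<Rightarrow> None | Some s \<Rightarrow> collapse_map Y (n - 1) (face X n i s)),
     degen = (\<lambda>n i x. case x of None \<Rightarrow> None | Some s \<Rightarrow> collapse_map Y (Suc n) (degen X n i s))\<rparr>"

definition simplicial_subset :: "'a sset \<Rightarrow> 'a sset \<Rightarrow> bool"
  where "simplicial_subset Y X \<longleftrightarrow>
    face Y = face X \<and> degen Y = degen X \<and> (\<forall>n. simp Y n \<subseteq> simp X n) \<and>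
    (\<forall>n. \<forall>x\<in>simp Y (Suc n). \<forall>i\<le>Suc n. face X (Suc n) i x \<in> simp Y n) \<and>
    (\<forall>n. \<forall>x\<in>simp Y n. \<forall>i\<le>n. degen X n i x \<in> simp Y (Suc n))"

lemma face_nerve:
  "length (face (nerve G) n i x) = n - 1"
  "k < n - 1 \<Longrightarrow> face (nerve G) n i x ! k = (if Suc k < i then x ! k
     else if Suc k = i then x ! k \<otimes>\<^bsub>G\<^esub> x ! Suc k else x ! Suc k)"
  by (auto simp: nerve_def)

lemma degen_nerve:
  "length (degen (nerve G) n i x) = Suc n"
  "k < Suc n \<Longrightarrow> degen (nerve G) n i x ! k = (if k < i then x ! k
     else if k = i then \<one>\<^bsub>G\<^esub> else x ! (k - 1))"
  by (auto simp: nerve_def simp del: upt_Suc)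

lemma simp_nerve: "x \<in> simp (nerve G) n \<longleftrightarrow> length x = n \<and> (\<forall>k<n. x ! k \<in> carrier G)"
  by (auto simp: nerve_def set_conv_nth)

context monoid begin

lemma nerve_face_face: assumes "x \<in> simp (nerve G) (Suc (Suc n))" "i < j" "j \<le> Suc (Suc n)"
  shows "face (nerve G) (Suc n) i (face (nerve G) (Suc (Suc n)) j x)
         = face (nerve G) (Suc n) (j - 1) (face (nerve G) (Suc (Suc n)) i x)"
proof (rule nth_equalityI)
  fix k assume "k < length (face (nerve G) (Suc n) i (face (nerve G) (Suc (Suc n)) j x))"
  then have k: "k < n" by (simp add: face_nerve)
  show "face (nerve G) (Suc n) i (face (nerve G) (Suc (Suc n)) j x) ! k
         = face (nerve G) (Suc n) (j - 1) (face (nerve G) (Suc (Suc n)) i x) ! k"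
  using assms k by (auto simp: face_nerve simp_nerve m_assoc)
qed (simp add: face_nerve)

lemma nerve_degen_degen: assumes "x \<in> simp (nerve G) n" "i \<le> j" "j \<le> n"
  shows "degen (nerve G) (Suc n) i (degen (nerve G) n j x)
        = degen (nerve G) (Suc n) (Suc j) (degen (nerve G) n i x)"
proof (rule nth_equalityI)
  fix k assume "k < length (degen (nerve G) (Suc n) i (degen (nerve G) n j x))"
  then have k: "k < Suc (Suc n)" by (simp add: degen_nerve)
  show "degen (nerve G) (Suc n) i (degen (nerve G) n j x) ! k
        = degen (nerve G) (Suc n) (Suc j) (degen (nerve G) n i x) ! k"
  using assms k by (auto simp: degen_nerve)
qed (simp add: degen_nerve)

lemma nerve_face_degen_eq: assumes "x \<in> simp (nerve G) n" "j \<le> n" "i = j \<or> i = Suc j"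
  shows "face (nerve G) (Suc n) i (degen (nerve G) n j x) = x"
proof (rule nth_equalityI)
  fix k assume "k < length (face (nerve G) (Suc n) i (degen (nerve G) n j x))"
  then have k: "k < n" by (simp add: face_nerve)
  show "face (nerve G) (Suc n) i (degen (nerve G) n j x) ! k = x ! k"
  using assms k by (auto simp: face_nerve degen_nerve simp_nerve)
qed (use assms in \<open>simp add: face_nerve simp_nerve\<close>)

lemma nerve_face_degen_less: assumes "x \<in> simp (nerve G) (Suc n)" "i < j" "j \<le> Suc n"
  shows "face (nerve G) (Suc (Suc n)) i (degen (nerve G) (Suc n) j x)
         = degen (nerve G) n (j - 1) (face (nerve G) (Suc n) i x)"
proof (rule nth_equalityI)
  fix k assume "k < length (face (nerve G) (Suc (Suc n)) i (degen (nerve G) (Suc n) j x))"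
  then have k: "k < Suc n" by (simp add: face_nerve)
  show "face (nerve G) (Suc (Suc n)) i (degen (nerve G) (Suc n) j x) ! k
         = degen (nerve G) n (j - 1) (face (nerve G) (Suc n) i x) ! k"
  using assms k by (auto simp: face_nerve degen_nerve simp_nerve)
qed (simp add: face_nerve degen_nerve)

lemma nerve_face_degen_greater: assumes "x \<in> simp (nerve G) (Suc n)" "Suc j < i" "i \<le> Suc (Suc n)"
  shows "face (nerve G) (Suc (Suc n)) i (degen (nerve G) (Suc n) j x)
         = degen (nerve G) n j (face (nerve G) (Suc n) (i - 1) x)"
proof (rule nth_equalityI)
  fix k assume "k < length (face (nerve G) (Suc (Suc n)) i (degen (nerve G) (Suc n) j x))"
  then have k: "k < Suc n" by (simp add: face_nerve)
  show "face (nerve G) (Suc (Suc n)) i (degen (nerve G) (Suc n) j x) ! k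
         = degen (nerve G) n j (face (nerve G) (Suc n) (i - 1) x) ! k"
  using assms k by (auto simp: face_nerve degen_nerve simp_nerve)
qed (simp add: face_nerve degen_nerve)

lemma nerve_face_closed: "x \<in> simp (nerve G) (Suc n) \<Longrightarrow> face (nerve G) (Suc n) i x \<in> simp (nerve G) n"
  by (auto simp: face_nerve simp_nerve)

lemma nerve_degen_closed: "x \<in> simp (nerve G) n \<Longrightarrow> i \<le> n \<Longrightarrow> degen (nerve G) n i x \<in> simp (nerve G) (Suc n)"
  by (auto simp: degen_nerve simp_nerve)

end

lemma simplicial_set_nerve:
  assumes "monoid G"
  shows "simplicial_set (nerve G)"
  unfolding simplicial_set_def
  using monoid.nerve_face_face[OF assms] monoid.nerve_degen_degen[OF assms] monoid.nerve_face_degen_eq[OF assms] monoid.nerve_face_degen_less[OF assms] 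
    monoid.nerve_face_degen_greater[OF assms] monoid.nerve_face_closed[OF assms] monoid.nerve_degen_closed[OF assms] by simp

lemma simplicial_set_face:
  "simplicial_set X \<Longrightarrow> x \<in> simp X (Suc n) \<Longrightarrow> i \<le> Suc n \<Longrightarrow> face X (Suc n) i x \<in> simp X n"
  by (simp add: simplicial_set_def)

lemma simplicial_set_degen:
  "simplicial_set X \<Longrightarrow> x \<in> simp X n \<Longrightarrow> i \<le> n \<Longrightarrow> degen X n i x \<in> simp X (Suc n)"
  by (simp add: simplicial_set_def)

lemma simplicial_set_subset:
  "simplicial_set X \<Longrightarrow> simplicial_subset Y X \<Longrightarrow> simplicial_set Y"
  by (simp add: simplicial_set_def simplicial_subset_def subset_iff)

lemma simplicial_set_collapse:
  assumes X: "simplicial_set X" and Y: "simplicial_subset Y X"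
  shows "simplicial_set (collapse X Y)"
proof -
  have f: "x \<in> simp Y (Suc n) \<Longrightarrow> i \<le> Suc n \<Longrightarrow> face X (Suc n) i x \<in> simp Y n"
   and g: "x \<in> simp Y n \<Longrightarrow> i \<le> n \<Longrightarrow> degen X n i x \<in> simp Y (Suc n)" for x n i
    using Y by (auto simp: simplicial_subset_def)
  have F: "face (collapse X Y) (Suc n) i (collapse_map Y (Suc n) x)
      = collapse_map Y n (face X (Suc n) i x)" if "i \<le> Suc n" for n i x
    using that f by (auto simp: collapse_def collapse_map_def)
  have D: "degen (collapse X Y) n i (collapse_map Y n x)
      = collapse_map Y (Suc n) (degen X n i x)" if "i \<le> n" for n i x
    using that g by (auto simp: collapse_def collapse_map_def)
  have N: "face (collapse X Y) n i None = None" "degen (collapse X Y) n i None = None" for n i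
    by (auto simp: collapse_def)
  have S: "simp (collapse X Y) n = insert None (collapse_map Y n ` simp X n)" for n
    by (auto simp: collapse_def collapse_map_def image_iff)
  show ?thesis
    using X unfolding simplicial_set_def S
    by (simp add: F D N)
qed

section \<open>Cohomology with coefficients in \<open>\<int>\<^sub>d\<close>\<close>

definition cochain_group :: "nat \<Rightarrow> 'a sset \<Rightarrow> nat \<Rightarrow> ('a \<Rightarrow> int) monoid"
  where "cochain_group d X n = product_group (simp X n) (\<lambda>_. integer_mod_group d)"

definition coboundary :: "nat \<Rightarrow> 'a sset \<Rightarrow> nat \<Rightarrow> ('a \<Rightarrow> int) \<Rightarrow> 'a \<Rightarrow> int"
  where "coboundary d X n f =
    (\<lambda>\<sigma>\<in>simp X (Suc n). (\<Sum>i\<le>Suc n. (- 1) ^ i * f (face X (Suc n) i \<sigma>)) mod int d)"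

definition cocycles :: "nat \<Rightarrow> 'a sset \<Rightarrow> nat \<Rightarrow> ('a \<Rightarrow> int) set"
  where "cocycles d X n =
    {f \<in> carrier (cochain_group d X n). coboundary d X n f = \<one>\<^bsub>cochain_group d X (Suc n)\<^esub>}"

definition coboundaries :: "nat \<Rightarrow> 'a sset \<Rightarrow> nat \<Rightarrow> ('a \<Rightarrow> int) set"
  where "coboundaries d X n = (case n of 0 \<Rightarrow> {\<one>\<^bsub>cochain_group d X 0\<^esub>}
    | Suc m \<Rightarrow> coboundary d X m ` carrier (cochain_group d X m))"

definition cohomology_group :: "nat \<Rightarrow> 'a sset \<Rightarrow> nat \<Rightarrow> ('a \<Rightarrow> int) set monoid"
  where "cohomology_group d X n =
    (cochain_group d X n)\<lparr>carrier := cocycles d X n\<rparr> Mod coboundaries d X n"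

definition cohomology_class :: "nat \<Rightarrow> 'a sset \<Rightarrow> nat \<Rightarrow> ('a \<Rightarrow> int) \<Rightarrow> ('a \<Rightarrow> int) set"
  where "cohomology_class d X n f = coboundaries d X n #>\<^bsub>cochain_group d X n\<^esub> f"

lemma cohomology_class_in_cohomology_group:
  "f \<in> cocycles d X n \<Longrightarrow> cohomology_class d X n f \<in> carrier (cohomology_group d X n)"
  by (auto simp: cohomology_group_def cohomology_class_def FactGroup_def RCOSETS_def r_coset_def)

text \<open>The linear system \<open>(A\<^sub>X, b\<^sub>\<gamma>)\<close> of a simplicial set with a 2-cochain.\<close>

definition system_of :: "nat \<Rightarrow> 'a sset \<Rightarrow> ('a \<Rightarrow> int) \<Rightarrow> ('a, 'a) lin_sys"
  where "system_of d X \<gamma> =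
    \<lparr>rows = simp X 2, cols = simp X 1,
     mat = (\<lambda>\<sigma> x. (\<Sum>i \<in> {i. i \<le> 2 \<and> face X 2 i \<sigma> = x}. (- 1) ^ i) mod int d),
     rhs = (\<lambda>\<sigma>. (- \<gamma> \<sigma>) mod int d)\<rparr>"

section \<open>The simplicial sets associated with a linear system\<close>

abbreviation fun_group :: "nat \<Rightarrow> ('r, 'c) lin_sys \<Rightarrow> ('c \<Rightarrow> int) monoid"
  where "fun_group d L \<equiv> product_group (cols L) (\<lambda>_. integer_mod_group d)"

definition fun_supp :: "('r, 'c) lin_sys \<Rightarrow> ('c \<Rightarrow> int) \<Rightarrow> 'c set"
  where "fun_supp L s = {v \<in> cols L. s v \<noteq> 0}"

definition row :: "('r, 'c) lin_sys \<Rightarrow> 'r \<Rightarrow> 'c \<Rightarrow> int"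
  where "row L i = restrict (mat L i) (cols L)"

definition row_group :: "nat \<Rightarrow> ('r, 'c) lin_sys \<Rightarrow> 'r \<Rightarrow> ('c \<Rightarrow> int) monoid"
  where "row_group d L i = subgroup_generated (fun_group d L) {row L i}"

definition standing_assumptions :: "nat \<Rightarrow> ('r, 'c) lin_sys \<Rightarrow> bool"
  where "standing_assumptions d L \<longleftrightarrow>
    (\<forall>i\<in>rows L. row_group d L i \<cong> integer_mod_group d) \<and>
    (\<forall>i\<in>rows L. \<forall>j\<in>rows L. i \<noteq> j \<longrightarrow>
       carrier (row_group d L i) \<noteq> carrier (row_group d L j) \<and>
       carrier (row_group d L i) \<inter> carrier (row_group d L j) = {\<one>\<^bsub>fun_group d L\<^esub>})"

definition N_complex :: "nat \<Rightarrow> ('r, 'c) lin_sys \<Rightarrow> ('c \<Rightarrow> int) list sset"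
  where "N_complex d L = (nerve (fun_group d L))
    \<lparr>simp := \<lambda>n. {xs \<in> simp (nerve (fun_group d L)) n.
       (\<Union>s\<in>set xs. fun_supp L s) \<in> complex_of L}\<rparr>"

text \<open>Adding the base point makes the wedge of an empty family of nerves a point.\<close>

definition N_wedge :: "nat \<Rightarrow> ('r, 'c) lin_sys \<Rightarrow> ('c \<Rightarrow> int) list sset"
  where "N_wedge d L = (nerve (fun_group d L))
    \<lparr>simp := \<lambda>n. insert (replicate n \<one>\<^bsub>fun_group d L\<^esub>)
       (\<Union>i\<in>rows L. simp (nerve (row_group d L i)) n)\<rparr>"

definition N_bar :: "nat \<Rightarrow> ('r, 'c) lin_sys \<Rightarrow> ('c \<Rightarrow> int) list option sset"
  where "N_bar d L = collapse (N_complex d L) (N_wedge d L)"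

lemma group_fun_group: "group (fun_group d L)"
  by simp

lemma one_row_group: "\<one>\<^bsub>row_group d L i\<^esub> = \<one>\<^bsub>fun_group d L\<^esub>" 
  unfolding row_group_def by (rule one_subgroup_generated)

lemma mult_row_group: "monoid.mult (row_group d L i) = monoid.mult (fun_group d L)" 
  unfolding row_group_def by (rule mult_subgroup_generated)

lemma nerve_row_group: "face (nerve (row_group d L i)) = face (nerve (fun_group d L))"
    "degen (nerve (row_group d L i)) = degen (nerve (fun_group d L))"
  by (simp_all only: nerve_def sset.simps one_row_group mult_row_group)

lemma complex_of_mono: assumes "\<sigma> \<in> complex_of L" "\<tau> \<subseteq> \<sigma>" shows "\<tau> \<in> complex_of L"
proof -
  consider "\<sigma> = {}" | v where "v \<in> cols L" "\<sigma> = {v}" | i where "i \<in> rows L" "\<sigma> \<subseteq> row_supp L i"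
    using assms(1) unfolding complex_of_def by blast
  then show ?thesis
  proof cases
    case 2
    then have "\<tau> = {} \<or> \<tau> = {v}" using assms(2) by blast
    then show ?thesis using 2 by (auto simp: complex_of_def)
  next
    case 3
    then have "\<tau> \<subseteq> row_supp L i" using assms(2) by blast
    with 3 show ?thesis unfolding complex_of_def by blast
  qed (use assms(2) in \<open>simp add: complex_of_def\<close>)
qed

lemma fun_supp_mult:
  "fun_supp L (s \<otimes>\<^bsub>fun_group d L\<^esub> t) \<subseteq> fun_supp L s \<union> fun_supp L t"
  by (auto simp: fun_supp_def)

lemma face_fun_supp:
  assumes "length x = Suc n"
  shows "(\<Union>s\<in>set (face (nerve (fun_group d L)) (Suc n) i x). fun_supp L s) \<subseteq> (\<Union>s\<in>set x. fun_supp L s)"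
proof -
    have *: "fun_supp L (x ! k) \<subseteq> (\<Union>s\<in>set x. fun_supp L s)" if "k < Suc n" for k
      using that assms by (metis UN_upper nth_mem)
    have m: "fun_supp L (x ! k \<otimes>\<^bsub>fun_group d L\<^esub> x ! Suc k) \<subseteq> (\<Union>s\<in>set x. fun_supp L s)" if "k < n" for k
    proof -
      note fun_supp_mult[where L = L and s = "x ! k" and t = "x ! Suc k" and d = d]
      then show ?thesis using *[of k] *[of "Suc k"] that by auto
    qed
    show ?thesis
    proof (rule UN_least)
      fix s assume "s \<in> set (face (nerve (fun_group d L)) (Suc n) i x)"
      then obtain k where "k \<in> {0..<Suc n - 1}" "s = (if Suc k < i then x ! k
        else if Suc k = i then x ! k \<otimes>\<^bsub>fun_group d L\<^esub> x ! Suc k else x ! Suc k)"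
        unfolding nerve_def sset.simps set_map set_upt by (elim imageE)
      then show "fun_supp L s \<subseteq> (\<Union>s\<in>set x. fun_supp L s)"
        using *[of k] *[of "Suc k"] m[of k] by (simp del: mult_product_group split: if_splits)
    qed
qed

lemma degen_fun_supp:
  assumes "length x = n" "i \<le> n"
  shows "(\<Union>s\<in>set (degen (nerve (fun_group d L)) n i x). fun_supp L s) \<subseteq> (\<Union>s\<in>set x. fun_supp L s)"
proof -
    have *: "fun_supp L (x ! k) \<subseteq> (\<Union>s\<in>set x. fun_supp L s)" if "k < n" for k
      using that assms by (metis UN_upper nth_mem)
    have one: "fun_supp L \<one>\<^bsub>fun_group d L\<^esub> = {}"
      by (auto simp: fun_supp_def)
    show ?thesis
    proof (rule UN_least)
      fix s assume "s \<in> set (degen (nerve (fun_group d L)) n i x)"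
      then obtain k where "k \<in> {0..<Suc n}" "s = (if k < i then x ! k
        else if k = i then \<one>\<^bsub>fun_group d L\<^esub> else x ! (k - 1))"
        unfolding nerve_def sset.simps set_map set_upt by (elim imageE)
      then show "fun_supp L s \<subseteq> (\<Union>s\<in>set x. fun_supp L s)"
        using *[of k] *[of "k - 1"] one assms(2) by (simp del: one_product_group split: if_splits)
    qed
qed

lemma simplicial_subset_N_complex:
  "simplicial_subset (N_complex d L) (nerve (fun_group d L))"
proof -
  let ?G = "fun_group d L"
  have len: "x \<in> simp (nerve ?G) n \<Longrightarrow> length x = n" for x n
    by (simp add: nerve_def)
  have N: "simplicial_set (nerve ?G)"
    by (intro simplicial_set_nerve group.is_monoid group_fun_group)
  note f = simplicial_set_face [OF N] and g = simplicial_set_degen [OF N]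
  have simp_N: "x \<in> simp (N_complex d L) n \<longleftrightarrow>
      x \<in> simp (nerve ?G) n \<and> (\<Union>s\<in>set x. fun_supp L s) \<in> complex_of L" for x n
    by (simp add: N_complex_def)
  have 1: "face (nerve ?G) (Suc n) i x \<in> simp (N_complex d L) n"
    if "x \<in> simp (N_complex d L) (Suc n)" "i \<le> Suc n" for n i x
  proof -
    note x = conjunct1[OF that(1)[unfolded simp_N]] conjunct2[OF that(1)[unfolded simp_N]]
    show ?thesis
      unfolding simp_N by (intro conjI f x that(2) complex_of_mono[OF x(2) face_fun_supp[OF len[OF x(1)]]])
  qed
  have 2: "degen (nerve ?G) n i x \<in> simp (N_complex d L) (Suc n)"
    if "x \<in> simp (N_complex d L) n" "i \<le> n" for n i x
  proof -
    note x = conjunct1[OF that(1)[unfolded simp_N]] conjunct2[OF that(1)[unfolded simp_N]]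
    show ?thesis
      unfolding simp_N by (intro conjI g x that(2) complex_of_mono[OF x(2) degen_fun_supp[OF len[OF x(1)] that(2)]])
  qed
  have 3: "face (N_complex d L) = face (nerve ?G)" "degen (N_complex d L) = degen (nerve ?G)"
    by (simp_all add: N_complex_def)
  have 4: "simp (N_complex d L) n \<subseteq> simp (nerve ?G) n" for n
    by (rule subsetI) (simp only: simp_N)
  show ?thesis
    unfolding simplicial_subset_def by (intro conjI allI ballI impI 1 2 3 4)
qed

lemma row_group_carrier:
  assumes "s \<in> carrier (row_group d L i)"
  shows "s \<in> carrier (fun_group d L) \<and> fun_supp L s \<subseteq> row_supp L i"
proof -
  have "s \<in> generate (fun_group d L) (carrier (fun_group d L) \<inter> {row L i})"
    using assms by (simp add: row_group_def carrier_subgroup_generated)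
  then show ?thesis
  proof (induction rule: generate.induct)
    case one
    show ?case by (auto simp: fun_supp_def)
  next
    case (incl h)
    then show ?case by (auto simp: fun_supp_def row_supp_def row_def)
  next
    case (inv h)
    then have h: "h \<in> carrier (fun_group d L)" "h = row L i" by auto
    have "fun_supp L (inv\<^bsub>fun_group d L\<^esub> h) \<subseteq> row_supp L i"
      using h by (auto simp: fun_supp_def row_supp_def row_def PiE_iff)
    with group.inv_closed[OF group_fun_group h(1)] show ?case by (intro conjI)
  next
    case (eng h1 h2)
    then have "h1 \<otimes>\<^bsub>fun_group d L\<^esub> h2 \<in> carrier (fun_group d L)"
      by (intro monoid.m_closed group.is_monoid group_fun_group) auto
    moreover have "fun_supp L (h1 \<otimes>\<^bsub>fun_group d L\<^esub> h2) \<subseteq> row_supp L i"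
      using eng.IH fun_supp_mult[where L = L and s = h1 and t = h2 and d = d] by blast
    ultimately show ?case by (intro conjI)
  qed
qed

lemma simplicial_subset_N_wedge:
  "simplicial_subset (N_wedge d L) (N_complex d L)"
proof -
  let ?G = "fun_group d L"
  have N: "simplicial_set (nerve (row_group d L i))" for i
    unfolding row_group_def
    by (intro simplicial_set_nerve group.is_monoid group.group_subgroup_generated group_fun_group)
  have one: "\<one>\<^bsub>?G\<^esub> \<otimes>\<^bsub>?G\<^esub> \<one>\<^bsub>?G\<^esub> = \<one>\<^bsub>?G\<^esub>" "\<one>\<^bsub>?G\<^esub> \<in> carrier ?G"
    by (rule monoid.l_one monoid.one_closed group.is_monoid group_fun_group)+
  have wedge: "x \<in> simp (N_wedge d L) n \<longleftrightarrow> x = replicate n \<one>\<^bsub>?G\<^esub> \<or>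
      (\<exists>j\<in>rows L. x \<in> simp (nerve (row_group d L j)) n)" for x n
    by (simp add: N_wedge_def)
  have rep: "face (nerve ?G) (Suc n) i (replicate (Suc n) \<one>\<^bsub>?G\<^esub>) = replicate n \<one>\<^bsub>?G\<^esub>" for n i
    using one(1) unfolding nerve_def sset.simps
    by (intro nth_equalityI; simp del: one_product_group mult_product_group upt_Suc replicate_Suc)
  have rep2: "degen (nerve ?G) n i (replicate n \<one>\<^bsub>?G\<^esub>) = replicate (Suc n) \<one>\<^bsub>?G\<^esub>" if "i \<le> n" for n i
    using that unfolding nerve_def sset.simps
    by (intro nth_equalityI; simp del: one_product_group upt_Suc replicate_Suc)
  have sub: "simp (N_wedge d L) n \<subseteq> simp (N_complex d L) n" for n
  proof -
    have "fun_supp L \<one>\<^bsub>?G\<^esub> = {}"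
      by (auto simp: fun_supp_def)
    then have "replicate n \<one>\<^bsub>?G\<^esub> \<in> simp (N_complex d L) n"
      using one(2) by (auto simp: N_complex_def nerve_def complex_of_def simp del: one_product_group)
    moreover have "x \<in> simp (N_complex d L) n"
      if "i \<in> rows L" "x \<in> simp (nerve (row_group d L i)) n" for i x
    proof -
      have x: "length x = n" "\<And>s. s \<in> set x \<Longrightarrow> s \<in> carrier (row_group d L i)"
        using that by (auto simp: nerve_def)
      have supp: "(\<Union>s\<in>set x. fun_supp L s) \<subseteq> row_supp L i"
        by (rule UN_least) (rule conjunct2 [OF row_group_carrier [OF x(2)]])
      have "set x \<subseteq> carrier ?G"
        by (rule subsetI) (rule conjunct1 [OF row_group_carrier [OF x(2)]])
      moreover have "(\<Union>s\<in>set x. fun_supp L s) \<in> complex_of L"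
        unfolding complex_of_def using that(1) supp by (intro UnI2 CollectI bexI)
      ultimately show ?thesis
        using x(1) by (simp add: N_complex_def nerve_def del: carrier_product_group)
    qed
    ultimately show ?thesis
      by (auto simp: N_wedge_def simp del: one_product_group)
  qed
  have face: "face (nerve ?G) (Suc n) i x \<in> simp (N_wedge d L) n"
    if x: "x \<in> simp (N_wedge d L) (Suc n)" and i: "i \<le> Suc n" for n i x
  proof (cases "x = replicate (Suc n) \<one>\<^bsub>?G\<^esub>")
    case True
    then show ?thesis using rep[of n i] unfolding wedge by simp
  next
    case False
    then obtain j where "j \<in> rows L" "x \<in> simp (nerve (row_group d L j)) (Suc n)"
      using x unfolding wedge by blast
    moreover from this i have "face (nerve ?G) (Suc n) i x \<in> simp (nerve (row_group d L j)) n"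
      using simplicial_set_face[OF N[of j]] by (simp add: nerve_row_group)
    ultimately show ?thesis
      unfolding wedge by blast
  qed
  have degen: "degen (nerve ?G) n i x \<in> simp (N_wedge d L) (Suc n)"
    if x: "x \<in> simp (N_wedge d L) n" and i: "i \<le> n" for n i x
  proof (cases "x = replicate n \<one>\<^bsub>?G\<^esub>")
    case True
    then show ?thesis using rep2[of i n] i unfolding wedge by simp
  next
    case False
    then obtain j where "j \<in> rows L" "x \<in> simp (nerve (row_group d L j)) n"
      using x unfolding wedge by blast
    moreover from this i have "degen (nerve ?G) n i x \<in> simp (nerve (row_group d L j)) (Suc n)"
      using simplicial_set_degen[OF N[of j]] by (simp add: nerve_row_group)
    ultimately show ?thesis
      unfolding wedge by blast
  qed
  have eq: "face (N_wedge d L) = face (N_complex d L)" "degen (N_wedge d L) = degen (N_complex d L)"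
    "face (N_complex d L) = face (nerve ?G)" "degen (N_complex d L) = degen (nerve ?G)"
    by (simp_all add: N_wedge_def N_complex_def)
  show ?thesis
    unfolding simplicial_subset_def
    by (intro conjI allI ballI impI eq(1,2) sub; unfold eq(3,4); intro face degen)
qed

lemma simplicial_set_N_bar: "simplicial_set (N_bar d L)"
  unfolding N_bar_def
  by (intro simplicial_set_collapse simplicial_subset_N_wedge
      simplicial_set_subset [OF simplicial_set_nerve simplicial_subset_N_complex]
      group.is_monoid group_fun_group)

text \<open>The cochain with value \<open>a b\<^sub>i\<close> on \<open>a A\<^sub>i\<close>; the value is unique under
  \<^const>\<open>standing_assumptions\<close>.\<close>

definition b_tilde :: "nat \<Rightarrow> ('r, 'c) lin_sys \<Rightarrow> ('c \<Rightarrow> int) list \<Rightarrow> int"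
  where "b_tilde d L = (\<lambda>x\<in>simp (N_complex d L) 1.
    if \<exists>i\<in>rows L. \<exists>a\<in>carrier (integer_mod_group d). x = [row L i [^]\<^bsub>fun_group d L\<^esub> a]
    then THE z. \<exists>i\<in>rows L. \<exists>a\<in>carrier (integer_mod_group d).
      x = [row L i [^]\<^bsub>fun_group d L\<^esub> a] \<and> z = (a * rhs L i) mod int d
    else 0)"

text \<open>The coboundary of \<^const>\<open>b_tilde\<close> vanishes on the wedge and so descends to the quotient.\<close>

definition gamma_b :: "nat \<Rightarrow> ('r, 'c) lin_sys \<Rightarrow> ('c \<Rightarrow> int) list option \<Rightarrow> int"
  where "gamma_b d L = (\<lambda>x\<in>simp (N_bar d L) 2.
    case x of None \<Rightarrow> 0 | Some \<sigma> \<Rightarrow> coboundary d (N_complex d L) 1 (b_tilde d L) \<sigma>)"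

lemma gamma_b_Some:
  assumes "Some [s1, s2] \<in> simp (N_bar d L) 2"
  shows "gamma_b d L (Some [s1, s2]) =
    (b_tilde d L [s1] + b_tilde d L [s2] - b_tilde d L [s1 \<otimes>\<^bsub>fun_group d L\<^esub> s2]) mod int d"
proof -
  have "[s1, s2] \<in> simp (N_complex d L) (Suc 1)"
    using assms by (auto simp: N_bar_def collapse_def numeral_2_eq_2)
  moreover have "face (N_complex d L) = face (nerve (fun_group d L))"
    by (simp add: N_complex_def)
  ultimately show ?thesis
    using assms by (simp add: gamma_b_def coboundary_def nerve_def algebra_simps del: mult_product_group)
qed

end

theory Submission
  imports Defs "HOL-Algebra.FiniteProduct"
begin

text \<open>
  A solution of a linear system in a group \<open>G\<close> consists of elements \<open>j\<close> and \<open>e\<^sub>v\<close> of \<open>G\<close> subject to the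
  relations of the solution group, and the solution group carries the universal solution. So it
  suffices to translate solutions of \<open>(A, b)\<close> in \<open>G\<close> into solutions of \<open>(A\<^sub>X, b\<^sub>\<gamma>)\<close> in \<open>G\<close> with the same
  \<open>j\<close> and back, by formulas that commute with homomorphisms. Both kinds of solutions are the same
  as maps \<open>T\<close> from the 1-simplices of \<open>N(\<int>\<^sub>d, \<Sigma>)\<close> to the centralizer of \<open>j\<close> in \<open>G\<close> such that
  \<open>T(s) T(t) = T(s + t)\<close> for every 2-simplex \<open>(s, t)\<close> and \<open>T(A\<^sub>i) = j\<^sup>b\<close> with exponent \<open>b = b\<^sub>i\<close>
  (\<open>simplexwise_hom\<close>).

  A solution \<open>e\<close> of \<open>(A, b)\<close> gives \<open>T(s)\<close> as the product of the powers of the \<open>e\<^sub>v\<close> with exponents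
  \<open>s(v)\<close>. The factors commute as the support of \<open>s\<close> is a simplex, and for a 2-simplex \<open>(s, t)\<close> the
  factors of \<open>T(s)\<close> and \<open>T(t)\<close> commute as well, whence multiplicativity
  (\<open>simplexwise_hom_extend_solution\<close>). Conversely \<open>e\<^sub>v\<close> is the value of \<open>T\<close> at the unit function of
  \<open>v\<close>; these values determine \<open>T\<close>, since a function supported in a simplex is built from unit
  functions within that simplex (\<open>simplexwise_hom_eq_row_product\<close>,
  \<open>operator_solution_of_simplexwise_hom\<close>).

  For a solution \<open>y\<close> of \<open>(A\<^sub>X, b\<^sub>\<gamma>)\<close>, the row of the image of \<open>(s, t)\<close> says that \<open>y\<close> is multiplicative
  there up to the power \<open>- \<gamma>\<close> of \<open>j\<close> (\<open>operator_solution_system_of\<close>). By definition of \<open>\<gamma>\<^sub>b\<close> and by the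
  hypothesis on the class of \<open>\<gamma>\<close>, the pullback of \<open>\<gamma>\<close> to \<open>N(\<int>\<^sub>d, \<Sigma>)\<close> is the coboundary of a cochain
  \<open>\<beta>\<close> that has the values \<open>a b\<^sub>i\<close> at \<open>a A\<^sub>i\<close>, up to a common constant (\<open>cocycle_lift\<close>). Multiplying
  the value of \<open>y\<close> at the image of \<open>s\<close> by the power \<open>\<beta>(s)\<close> of \<open>j\<close> therefore yields a multiplicative
  map \<open>T\<close>. That \<open>y\<close> takes a single value on the collapsed wedge corresponds exactly to the values
  of \<open>T\<close> prescribed at the rows (\<open>operator_solution_twist\<close>, \<open>simplexwise_hom_untwist\<close>).
\<close>

section \<open>Evaluating words in a group\<close>

definition list_prod :: "('a, 'm) monoid_scheme \<Rightarrow> 'a list \<Rightarrow> 'a"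
  where "list_prod G xs = foldr (monoid.mult G) xs \<one>\<^bsub>G\<^esub>"

definition eval_word :: "('a, 'm) monoid_scheme \<Rightarrow> ('g \<Rightarrow> 'a) \<Rightarrow> 'g word \<Rightarrow> 'a"
  where "eval_word G f w = list_prod G (map (\<lambda>(g, p). if p then f g else inv\<^bsub>G\<^esub> f g) w)"

lemma list_prod_simps [simp]:
  "list_prod G [] = \<one>\<^bsub>G\<^esub>" "list_prod G (x # xs) = x \<otimes>\<^bsub>G\<^esub> list_prod G xs"
  by (simp_all add: list_prod_def)

lemma eval_word_Nil [simp]: "eval_word G f [] = \<one>\<^bsub>G\<^esub>"
  by (simp add: eval_word_def)

context group
begin

lemma list_prod_closed: "set xs \<subseteq> carrier G \<Longrightarrow> list_prod G xs \<in> carrier G"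
  by (induction xs) auto

lemma list_prod_append:
  "set xs \<subseteq> carrier G \<Longrightarrow> set ys \<subseteq> carrier G
    \<Longrightarrow> list_prod G (xs @ ys) = list_prod G xs \<otimes> list_prod G ys"
  by (induction xs) (auto simp: list_prod_closed m_assoc)

lemma list_prod_replicate: "x \<in> carrier G \<Longrightarrow> list_prod G (replicate n x) = x [^] n"
  by (induction n) (simp_all add: nat_pow_Suc2 [symmetric])

lemma letters_closed:
  "f \<in> S \<rightarrow> carrier G \<Longrightarrow> w \<in> words S
    \<Longrightarrow> set (map (\<lambda>(g, p). if p then f g else inv f g) w) \<subseteq> carrier G"
  by (induction w) (auto simp: Pi_iff)

lemma eval_word_closed:
  "f \<in> S \<rightarrow> carrier G \<Longrightarrow> w \<in> words S \<Longrightarrow> eval_word G f w \<in> carrier G"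
  unfolding eval_word_def by (rule list_prod_closed) (rule letters_closed)

lemma eval_word_append:
  "f \<in> S \<rightarrow> carrier G \<Longrightarrow> u \<in> words S \<Longrightarrow> v \<in> words S
    \<Longrightarrow> eval_word G f (u @ v) = eval_word G f u \<otimes> eval_word G f v"
  unfolding eval_word_def map_append by (rule list_prod_append) (rule letters_closed; assumption)+

lemma eval_word_gen_power:
  assumes "f g \<in> carrier G" "0 \<le> k"
  shows "eval_word G f (gen_power g k) = f g [^] k"
  using assms int_pow_int [of G "f g" "nat k"]
  by (simp add: eval_word_def map_replicate list_prod_replicate)

end

section \<open>The universal property of a presentation\<close>

definition gen_class :: "'g set \<Rightarrow> ('g word \<times> 'g word) set \<Rightarrow> 'g \<Rightarrow> 'g word set"
  where "gen_class S Rel g = pres_rel S Rel `` {[(g, True)]}"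

lemma class_in_presented_group:
  "w \<in> words S \<Longrightarrow> pres_rel S Rel `` {w} \<in> carrier (presented_group S Rel)"
  by (simp add: presented_group_def quotientI)

lemma one_presented_group: "\<one>\<^bsub>presented_group S Rel\<^esub> = pres_rel S Rel `` {[]}"
  by (simp add: presented_group_def)

lemma gen_class_closed: "g \<in> S \<Longrightarrow> gen_class S Rel g \<in> carrier (presented_group S Rel)"
  unfolding gen_class_def by (rule class_in_presented_group) auto

lemma inv_gen_class:
  assumes "g \<in> S"
  shows "inv\<^bsub>presented_group S Rel\<^esub> gen_class S Rel g = pres_rel S Rel `` {[(g, False)]}"
proof (rule group.inv_equality [OF group_presented_group])
  have "[(g, False)] \<in> words S" "[(g, True)] \<in> words S" using assms by auto
  then show "pres_rel S Rel `` {[(g, False)]} \<otimes>\<^bsub>presented_group S Rel\<^esub> gen_class S Rel g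
      = \<one>\<^bsub>presented_group S Rel\<^esub>"
    unfolding gen_class_def one_presented_group
    using pres_rel.cancel [OF assms, of False Rel]
    by (simp add: presented_group_mult equiv_class_eq [OF equiv_pres_rel])
  show "pres_rel S Rel `` {[(g, False)]} \<in> carrier (presented_group S Rel)"
    by (rule class_in_presented_group) (use assms in auto)
qed (rule gen_class_closed [OF assms])

text \<open>The class of a word is its value at the classes of the generators; hence the relators hold
  in the presented group and its generators determine homomorphisms out of it.\<close>

lemma eval_word_gen_class:
  "w \<in> words S \<Longrightarrow> eval_word (presented_group S Rel) (gen_class S Rel) w = pres_rel S Rel `` {w}"
proof (induction w)
  case Nil
  show ?case by (simp add: one_presented_group)
next
  case (Cons a w)
  obtain g p where a: "a = (g, p)" by (cases a)
  have g: "g \<in> S" "[(g, p)] \<in> words S" "w \<in> words S" using Cons.prems a by auto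
  have "(if p then gen_class S Rel g else inv\<^bsub>presented_group S Rel\<^esub> gen_class S Rel g)
      = pres_rel S Rel `` {[(g, p)]}"
    using inv_gen_class [OF g(1)] by (cases p) (auto simp: gen_class_def)
  then show ?case
    using Cons.IH [OF g(3)] presented_group_mult [OF g(2,3), of Rel]
    by (simp add: eval_word_def a)
qed

lemma gen_class_relation:
  assumes "(u, v) \<in> Rel" "u \<in> words S" "v \<in> words S"
  shows "eval_word (presented_group S Rel) (gen_class S Rel) u
    = eval_word (presented_group S Rel) (gen_class S Rel) v"
  using pres_rel.relation [OF assms] assms(2,3)
  by (simp add: eval_word_gen_class equiv_class_eq [OF equiv_pres_rel])

lemma presented_group_hom_exists:
  assumes "group G" and f: "f \<in> S \<rightarrow> carrier G"
    and rel: "\<And>u v. (u, v) \<in> Rel \<Longrightarrow> u \<in> words S \<Longrightarrow> v \<in> words S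
      \<Longrightarrow> eval_word G f u = eval_word G f v"
  shows "\<exists>h\<in>hom (presented_group S Rel) G. \<forall>g\<in>S. h (gen_class S Rel g) = f g"
proof -
  interpret group G by fact
  have inv: "eval_word G f u = eval_word G f v" if "(u, v) \<in> pres_rel S Rel" for u v
    using that
  proof (induction rule: pres_rel.induct)
    case (append u v u' v')
    then show ?case
      using pres_rel_words [OF append.hyps(1)] pres_rel_words [OF append.hyps(2)]
      by (simp only: eval_word_append [OF f])
  next
    case (cancel g p)
    then have "f g \<in> carrier G" using f by auto
    then show ?case by (cases p) (simp_all add: eval_word_def)
  qed (auto simp: rel)
  define h where "h U = eval_word G f (SOME u. u \<in> U)" for U
  have h: "h (pres_rel S Rel `` {w}) = eval_word G f w" if "w \<in> words S" for w
  proof -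
    have "w \<in> pres_rel S Rel `` {w}" using that by (auto intro: pres_rel.refl)
    then have "(SOME u. u \<in> pres_rel S Rel `` {w}) \<in> pres_rel S Rel `` {w}" by (rule someI)
    then show ?thesis using inv by (simp add: h_def)
  qed
  have "h \<in> hom (presented_group S Rel) G"
  proof (rule homI)
    fix x assume "x \<in> carrier (presented_group S Rel)"
    then obtain u where u: "u \<in> words S" "x = pres_rel S Rel `` {u}"
      by (auto simp: presented_group_def elim!: quotientE)
    then show "h x \<in> carrier G" by (simp add: h eval_word_closed [OF f])
    fix y assume "y \<in> carrier (presented_group S Rel)"
    then obtain v where v: "v \<in> words S" "y = pres_rel S Rel `` {v}"
      by (auto simp: presented_group_def elim!: quotientE)
    have "u @ v \<in> words S" using u v by simp
    then show "h (x \<otimes>\<^bsub>presented_group S Rel\<^esub> y) = h x \<otimes>\<^bsub>G\<^esub> h y"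
      by (simp only: u(2) v(2) presented_group_mult [OF u(1) v(1)] h u(1) v(1)
          eval_word_append [OF f u(1) v(1)])
  qed
  moreover have "h (gen_class S Rel g) = f g" if "g \<in> S" for g
  proof -
    have "f g \<in> carrier G" "[(g, True)] \<in> words S" using f that by auto
    then show ?thesis using h [of "[(g, True)]"] by (simp add: gen_class_def eval_word_def)
  qed
  ultimately show ?thesis by blast
qed

lemma presented_group_endo_id:
  assumes h: "h \<in> hom (presented_group S Rel) (presented_group S Rel)"
    and gen: "\<And>g. g \<in> S \<Longrightarrow> h (gen_class S Rel g) = gen_class S Rel g"
    and x: "x \<in> carrier (presented_group S Rel)"
  shows "h x = x"
proof -
  let ?P = "presented_group S Rel"
  interpret P: group ?P by (rule group_presented_group)
  interpret h: group_hom ?P ?P h by unfold_locales (rule h)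
  have "h (eval_word ?P (gen_class S Rel) w) = eval_word ?P (gen_class S Rel) w"
    if "w \<in> words S" for w
    using that
  proof (induction w rule: list.induct)
    case (Cons a w)
    then have "eval_word ?P (gen_class S Rel) w \<in> carrier ?P"
      by (intro P.eval_word_closed [where S = S]) (auto simp: gen_class_closed)
    moreover obtain g p where a: "a = (g, p)" by (cases a)
    moreover have g: "g \<in> S" "gen_class S Rel g \<in> carrier ?P"
      using Cons.prems a by (auto simp: gen_class_closed)
    moreover have "w \<in> words S" using Cons.prems by simp
    ultimately show ?case
      using Cons.IH gen [OF g(1)] by (simp add: eval_word_def)
  qed simp
  moreover obtain w where "w \<in> words S" "x = pres_rel S Rel `` {w}"
    using x by (auto simp: presented_group_def elim!: quotientE)
  ultimately show ?thesis by (simp add: eval_word_gen_class)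
qed

lemma presented_groups_iso:
  assumes h: "h \<in> hom (presented_group S R) (presented_group S' R')"
    and k: "k \<in> hom (presented_group S' R') (presented_group S R)"
    and kh: "\<And>g. g \<in> S \<Longrightarrow> k (h (gen_class S R g)) = gen_class S R g"
    and hk: "\<And>g. g \<in> S' \<Longrightarrow> h (k (gen_class S' R' g)) = gen_class S' R' g"
  shows "presented_group S R \<cong> presented_group S' R'"
proof -
  have "k (h x) = x" if "x \<in> carrier (presented_group S R)" for x
    using presented_group_endo_id [OF hom_compose [OF h k] _ that] kh by (simp add: o_def)
  moreover have "h (k x) = x" if "x \<in> carrier (presented_group S' R')" for x
    using presented_group_endo_id [OF hom_compose [OF k h] _ that] hk by (simp add: o_def)
  ultimately have "group_isomorphisms (presented_group S R) (presented_group S' R') h k"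
    using h k by (simp add: group_isomorphisms_def)
  then show ?thesis by (intro is_isoI group_isomorphisms_imp_iso)
qed

section \<open>Solutions of a linear system in a group\<close>

definition row_product :: "('a, 'm) monoid_scheme \<Rightarrow> ('c \<Rightarrow> 'a) \<Rightarrow> ('c \<Rightarrow> int) \<Rightarrow> 'c list \<Rightarrow> 'a"
  where "row_product G e n vs = list_prod G (map (\<lambda>v. e v [^]\<^bsub>G\<^esub> n v) vs)"

text \<open>A solution of the system with values in \<open>G\<close> assigns to the generators \<open>J\<close> and \<open>E v\<close> elements
  satisfying the defining relations of the solution group, so that solutions in \<open>G\<close> and
  homomorphisms from the solution group to \<open>G\<close> are the same thing. Integer exponents are used
  instead of repeated letters, so that the exponents can be reduced modulo \<open>d\<close>.\<close>

definition operator_solution ::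
    "nat \<Rightarrow> ('r, 'c) lin_sys \<Rightarrow> ('a, 'm) monoid_scheme \<Rightarrow> 'a \<Rightarrow> ('c \<Rightarrow> 'a) \<Rightarrow> bool"
  where "operator_solution d L G j e \<longleftrightarrow>
    j \<in> carrier G \<and> j [^]\<^bsub>G\<^esub> int d = \<one>\<^bsub>G\<^esub> \<and>
    (\<forall>v\<in>cols L. e v \<in> carrier G \<and> e v [^]\<^bsub>G\<^esub> int d = \<one>\<^bsub>G\<^esub> \<and> j \<otimes>\<^bsub>G\<^esub> e v = e v \<otimes>\<^bsub>G\<^esub> j) \<and>
    (\<forall>i\<in>rows L. \<forall>v\<in>row_supp L i. \<forall>w\<in>row_supp L i. e v \<otimes>\<^bsub>G\<^esub> e w = e w \<otimes>\<^bsub>G\<^esub> e v) \<and>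
    (\<forall>i\<in>rows L. \<forall>vs. distinct vs \<longrightarrow> set vs = row_supp L i
       \<longrightarrow> row_product G e (mat L i) vs = j [^]\<^bsub>G\<^esub> rhs L i)"

lemma operator_solutionD:
  assumes "operator_solution d L G j e"
  shows "j \<in> carrier G" "j [^]\<^bsub>G\<^esub> int d = \<one>\<^bsub>G\<^esub>"
    "v \<in> cols L \<Longrightarrow> e v \<in> carrier G" "v \<in> cols L \<Longrightarrow> e v [^]\<^bsub>G\<^esub> int d = \<one>\<^bsub>G\<^esub>"
    "v \<in> cols L \<Longrightarrow> j \<otimes>\<^bsub>G\<^esub> e v = e v \<otimes>\<^bsub>G\<^esub> j"
    "i \<in> rows L \<Longrightarrow> v \<in> row_supp L i \<Longrightarrow> w \<in> row_supp L i \<Longrightarrow> e v \<otimes>\<^bsub>G\<^esub> e w = e w \<otimes>\<^bsub>G\<^esub> e v"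
    "i \<in> rows L \<Longrightarrow> distinct vs \<Longrightarrow> set vs = row_supp L i
      \<Longrightarrow> row_product G e (mat L i) vs = j [^]\<^bsub>G\<^esub> rhs L i"
  using assms unfolding operator_solution_def by blast+

text \<open>Besides the subsets of row supports, the complex contains only singletons and the empty set, so
  commutation within each row gives commutation within each simplex.\<close>

lemma operator_solution_commute:
  assumes "operator_solution d L G j e" "\<sigma> \<in> complex_of L"
    "x \<in> insert j (e ` \<sigma>)" "y \<in> insert j (e ` \<sigma>)"
  shows "x \<otimes>\<^bsub>G\<^esub> y = y \<otimes>\<^bsub>G\<^esub> x"
proof -
  note sol = operator_solutionD [OF assms(1)]
  have sub: "\<sigma> \<subseteq> cols L"
    using assms(2) by (auto simp: complex_of_def row_supp_def)
  have "e v \<otimes>\<^bsub>G\<^esub> e w = e w \<otimes>\<^bsub>G\<^esub> e v" if "v \<in> \<sigma>" "w \<in> \<sigma>" for v w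
    using assms(2) that sol(6) unfolding complex_of_def by blast
  moreover have "j \<otimes>\<^bsub>G\<^esub> e v = e v \<otimes>\<^bsub>G\<^esub> j" if "v \<in> \<sigma>" for v
    using that sub sol(5) by blast
  ultimately show ?thesis
    using assms(3,4) by (elim insertE imageE) simp_all
qed

lemma complex_of_subset_cols: "\<sigma> \<in> complex_of L \<Longrightarrow> \<sigma> \<subseteq> cols L"
  by (auto simp: complex_of_def row_supp_def)

lemma finite_complex_of: "linear_system d L \<Longrightarrow> \<sigma> \<in> complex_of L \<Longrightarrow> finite \<sigma>"
  by (auto simp: complex_of_def linear_system_def intro: finite_subset)

lemma linear_system_nonneg:
  assumes "linear_system d L" "0 < d" "i \<in> rows L"
  shows "0 \<le> rhs L i" "v \<in> cols L \<Longrightarrow> 0 \<le> mat L i v"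
  using assms by (auto simp: linear_system_def carrier_integer_mod_group)

abbreviation sol_gens :: "('r, 'c) lin_sys \<Rightarrow> 'c sol_gen set"
  where "sol_gens L \<equiv> insert J (E ` cols L)"

definition sol_class :: "nat \<Rightarrow> ('r, 'c) lin_sys \<Rightarrow> 'c sol_gen \<Rightarrow> 'c sol_gen word set"
  where "sol_class d L = gen_class (sol_gens L) (solution_relations d L)"

lemma group_solution_group: "group (solution_group d L)"
  unfolding solution_group_def by (rule group_presented_group)

lemma (in group) eval_word_row:
  assumes "\<And>v. v \<in> set vs \<Longrightarrow> f (E v) \<in> carrier G \<and> 0 \<le> n v"
  shows "eval_word G f (concat (map (\<lambda>v. gen_power (E v) (n v)) vs))
    = row_product G (\<lambda>v. f (E v)) n vs"
  using assms
proof (induction vs)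
  case Nil
  show ?case by (simp add: row_product_def)
next
  case (Cons v vs)
  have f: "f \<in> E ` set (v # vs) \<rightarrow> carrier G" using Cons.prems by auto
  have w: "gen_power (E v) (n v) \<in> words (E ` set (v # vs))"
    "concat (map (\<lambda>v. gen_power (E v) (n v)) vs) \<in> words (E ` set (v # vs))"
    by (auto simp: in_lists_conv_set)
  from Cons.prems have "eval_word G f (gen_power (E v) (n v)) = f (E v) [^] n v"
    by (intro eval_word_gen_power) auto
  with Cons.IH Cons.prems eval_word_append [OF f w] show ?case
    by (simp add: row_product_def)
qed

lemma concat_gen_power_words:
  "set vs \<subseteq> cols L \<Longrightarrow> concat (map (\<lambda>v. gen_power (E v) (n v)) vs) \<in> words (sol_gens L)"
  by (auto simp: in_lists_conv_set)

lemma operator_solution_eval_word: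
  assumes "group G" "linear_system d L" "0 < d" "operator_solution d L G j e"
    and "(u, v) \<in> solution_relations d L"
  shows "eval_word G (case_sol_gen j e) u = eval_word G (case_sol_gen j e) v"
proof -
  interpret group G by fact
  note sol = operator_solutionD [OF assms(4)]
  consider "u = gen_power J (int d)" "v = []"
    | c where "c \<in> cols L" "u = gen_power (E c) (int d)" "v = []"
    | g h \<sigma> where "\<sigma> \<in> complex_of L" "g \<in> insert J (E ` \<sigma>)" "h \<in> insert J (E ` \<sigma>)"
        "u = [(g, True), (h, True)]" "v = [(h, True), (g, True)]"
    | i vs where "i \<in> rows L" "distinct vs" "set vs = row_supp L i"
        "u = concat (map (\<lambda>v. gen_power (E v) (mat L i v)) vs)" "v = gen_power J (rhs L i)"
    using assms(5) unfolding solution_relations_def by blast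
  then show ?thesis
  proof cases
    case 1
    then show ?thesis
      using sol(1,2) by (simp only: eval_word_gen_power sol_gen.case eval_word_Nil of_nat_0_le_iff)
  next
    case 2
    then show ?thesis
      using sol(3,4) by (simp only: eval_word_gen_power sol_gen.case eval_word_Nil of_nat_0_le_iff)
  next
    case 3
    let ?f = "case_sol_gen j e"
    have *: "?f g \<in> insert j (e ` \<sigma>)" "?f h \<in> insert j (e ` \<sigma>)" using 3 by auto
    then have "?f g \<in> carrier G" "?f h \<in> carrier G"
      using sol(1,3) complex_of_subset_cols [OF 3(1)] by auto
    then show ?thesis
      using operator_solution_commute [OF assms(4) 3(1) *] 3(4,5) by (simp add: eval_word_def)
  next
    case 4
    have "w \<in> set vs \<Longrightarrow> case_sol_gen j e (E w) \<in> carrier G \<and> 0 \<le> mat L i w" for w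
      using 4(1,3) sol(3) linear_system_nonneg [OF assms(2,3)] by (auto simp: row_supp_def)
    from eval_word_row [of vs "case_sol_gen j e", OF this] show ?thesis
      using sol(1) sol(7) [OF 4(1,2,3)] linear_system_nonneg(1) [OF assms(2,3) 4(1)] 4(4,5)
      by (simp add: eval_word_gen_power)
  qed
qed

lemma solution_group_hom_exists:
  assumes "group G" "linear_system d L" "0 < d" "operator_solution d L G j e"
  obtains h where "h \<in> hom (solution_group d L) G" "h (sol_class d L J) = j"
    "\<And>v. v \<in> cols L \<Longrightarrow> h (sol_class d L (E v)) = e v"
proof -
  note sol = operator_solutionD [OF assms(4)]
  have "case_sol_gen j e \<in> sol_gens L \<rightarrow> carrier G"
    using sol(1,3) by auto
  from presented_group_hom_exists [OF assms(1) this operator_solution_eval_word [OF assms]]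
  obtain h where "h \<in> hom (solution_group d L) G"
    "\<forall>g\<in>sol_gens L. h (sol_class d L g) = case_sol_gen j e g"
    unfolding solution_group_def sol_class_def by blast
  with that show ?thesis by simp
qed

lemma operator_solution_solution_group:
  fixes L :: "('r, 'c) lin_sys"
  assumes "linear_system d L" "0 < d"
  shows "operator_solution d L (solution_group d L) (sol_class d L J) (\<lambda>v. sol_class d L (E v))"
proof -
  let ?G = "solution_group d L" and ?f = "sol_class d L"
  interpret group ?G by (rule group_solution_group)
  have f: "?f g \<in> carrier ?G" if "g \<in> sol_gens L" for g
    using that unfolding sol_class_def solution_group_def by (rule gen_class_closed)
  have rel: "eval_word ?G ?f u = eval_word ?G ?f v"
    if "(u, v) \<in> solution_relations d L" "u \<in> words (sol_gens L)" "v \<in> words (sol_gens L)" for u v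
    using gen_class_relation [OF that] unfolding sol_class_def solution_group_def .
  have pow: "?f g [^]\<^bsub>?G\<^esub> int d = \<one>\<^bsub>?G\<^esub>" if "g \<in> sol_gens L" for g
  proof -
    have "(gen_power g (int d), []) \<in> solution_relations d L"
      using that by (auto simp: solution_relations_def)
    from rel [OF this] show ?thesis
      using that f eval_word_gen_power [of ?f g "int d"] by (auto simp: in_lists_conv_set)
  qed
  have comm: "?f g \<otimes>\<^bsub>?G\<^esub> ?f h = ?f h \<otimes>\<^bsub>?G\<^esub> ?f g"
    if "\<sigma> \<in> complex_of L" "g \<in> insert J (E ` \<sigma>)" "h \<in> insert J (E ` \<sigma>)" for g h \<sigma>
  proof -
    have "([(g, True), (h, True)], [(h, True), (g, True)]) \<in> solution_relations d L"
      using that by (auto simp: solution_relations_def)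
    moreover have "g \<in> sol_gens L" "h \<in> sol_gens L"
      using that complex_of_subset_cols [OF that(1)] by auto
    ultimately show ?thesis
      using rel [of "[(g, True), (h, True)]" "[(h, True), (g, True)]"] f
      by (simp add: eval_word_def)
  qed
  have row: "row_product ?G (\<lambda>v. ?f (E v)) (mat L i) vs = ?f J [^]\<^bsub>?G\<^esub> rhs L i"
    if "i \<in> rows L" "distinct vs" "set vs = row_supp L i" for i vs
  proof -
    have r: "(concat (map (\<lambda>v. gen_power (E v) (mat L i v)) vs), gen_power J (rhs L i))
        \<in> solution_relations d L"
      using that unfolding solution_relations_def by blast
    have vs: "set vs \<subseteq> cols L" using that(3) by (auto simp: row_supp_def)
    then have "w \<in> set vs \<Longrightarrow> ?f (E w) \<in> carrier ?G \<and> 0 \<le> mat L i w" for w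
      using linear_system_nonneg(2) [OF assms that(1)] f by auto
    from eval_word_row [of vs ?f, OF this] rel [OF r concat_gen_power_words [OF vs]] show ?thesis
      using linear_system_nonneg(1) [OF assms that(1)] f eval_word_gen_power [of ?f J "rhs L i"]
      by (auto simp: in_lists_conv_set)
  qed
  have "?f J \<otimes>\<^bsub>?G\<^esub> ?f (E v) = ?f (E v) \<otimes>\<^bsub>?G\<^esub> ?f J" if "v \<in> cols L" for v
    using that by (intro comm [of "{v}"]) (auto simp: complex_of_def)
  moreover have "?f (E v) \<otimes>\<^bsub>?G\<^esub> ?f (E w) = ?f (E w) \<otimes>\<^bsub>?G\<^esub> ?f (E v)"
    if "i \<in> rows L" "v \<in> row_supp L i" "w \<in> row_supp L i" for i v w
    using that by (intro comm [of "row_supp L i"]) (auto simp: complex_of_def)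
  ultimately show ?thesis
    using f pow row by (simp add: operator_solution_def)
qed

text \<open>A solution of each system in the solution group of the other one yields homomorphisms in both
  directions. The conditions \<open>ye\<close> and \<open>ey\<close> say that the composites fix the generators; \<open>h\<close> and \<open>k\<close>
  are arbitrary there because only their values on generators are known.\<close>

lemma solution_groups_isoI:
  assumes lin: "linear_system d L" "linear_system d L'" "0 < d"
    and e: "operator_solution d L (solution_group d L') (sol_class d L' J) e"
    and y: "operator_solution d L' (solution_group d L) (sol_class d L J) y"
    and ye: "\<And>h x. h \<in> hom (solution_group d L) (solution_group d L') \<Longrightarrow>
      h (sol_class d L J) = sol_class d L' J \<Longrightarrow>
      (\<And>v. v \<in> cols L \<Longrightarrow> h (sol_class d L (E v)) = e v) \<Longrightarrow> x \<in> cols L' \<Longrightarrow>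
      h (y x) = sol_class d L' (E x)"
    and ey: "\<And>k v. k \<in> hom (solution_group d L') (solution_group d L) \<Longrightarrow>
      k (sol_class d L' J) = sol_class d L J \<Longrightarrow>
      (\<And>x. x \<in> cols L' \<Longrightarrow> k (sol_class d L' (E x)) = y x) \<Longrightarrow> v \<in> cols L \<Longrightarrow>
      k (e v) = sol_class d L (E v)"
  shows "solution_group d L \<cong> solution_group d L'"
proof -
  obtain h where h: "h \<in> hom (solution_group d L) (solution_group d L')"
    "h (sol_class d L J) = sol_class d L' J"
    "\<And>v. v \<in> cols L \<Longrightarrow> h (sol_class d L (E v)) = e v"
    using solution_group_hom_exists [OF group_solution_group lin(1,3) e] by metis
  obtain k where k: "k \<in> hom (solution_group d L') (solution_group d L)"
    "k (sol_class d L' J) = sol_class d L J"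
    "\<And>x. x \<in> cols L' \<Longrightarrow> k (sol_class d L' (E x)) = y x"
    using solution_group_hom_exists [OF group_solution_group lin(2,3) y] by metis
  have "k (h (sol_class d L g)) = sol_class d L g" if "g \<in> sol_gens L" for g
    using that h(2,3) k(2) ey [OF k] by auto
  moreover have "h (k (sol_class d L' g)) = sol_class d L' g" if "g \<in> sol_gens L'" for g
    using that k(2,3) h(2) ye [OF h] by auto
  ultimately show ?thesis
    using h(1) k(1) unfolding solution_group_def sol_class_def
    by (intro presented_groups_iso) auto
qed

section \<open>Commuting elements\<close>

context group
begin

lemma commutes_with_generate:
  assumes "x \<in> generate G U" "U \<subseteq> carrier G" "z \<in> carrier G"
    and "\<And>u. u \<in> U \<Longrightarrow> z \<otimes> u = u \<otimes> z"
  shows "z \<otimes> x = x \<otimes> z"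
  using assms(1)
proof (induction rule: generate.induct)
  case one
  then show ?case using assms(3) by simp
next
  case (incl h)
  then show ?case using assms(4) by simp
next
  case (inv h)
  then have h: "h \<in> carrier G" "z \<otimes> h = h \<otimes> z" using assms by auto
  then have "inv h \<otimes> (z \<otimes> h) \<otimes> inv h = inv h \<otimes> (h \<otimes> z) \<otimes> inv h" by simp
  then show ?case using h(1) assms(3) by (metis inv_closed inv_solve_right m_assoc m_closed l_inv l_one)
next
  case (eng x y)
  then have "x \<in> carrier G" "y \<in> carrier G"
    using generate_in_carrier [OF assms(2)] by auto
  then show ?case using eng.IH assms(3) by (metis m_assoc)
qed

text \<open>Elements that commute pairwise lie in a commutative subgroup, in which products over a set
  make sense; an exponent of the generators is an exponent of the whole subgroup.\<close>

lemma commuting_subgroup: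
  assumes U: "U \<subseteq> carrier G" and comm: "\<And>x y. x \<in> U \<Longrightarrow> y \<in> U \<Longrightarrow> x \<otimes> y = y \<otimes> x"
    and tors: "\<And>x. x \<in> U \<Longrightarrow> x [^] (k :: int) = \<one>"
  shows "comm_group (subgroup_generated G U)" "U \<subseteq> carrier (subgroup_generated G U)"
    "\<And>x. x \<in> carrier (subgroup_generated G U) \<Longrightarrow> x [^] k = \<one>"
proof -
  let ?C = "subgroup_generated G U"
  have C: "carrier ?C = generate G U"
    using U by (simp add: carrier_subgroup_generated Int_absorb1)
  have com: "x \<otimes> y = y \<otimes> x" if "x \<in> generate G U" "y \<in> generate G U" for x y
  proof (rule commutes_with_generate [OF that(2) U])
    show "x \<in> carrier G" using generate_in_carrier [OF U that(1)] .
    fix u assume "u \<in> U"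
    then show "x \<otimes> u = u \<otimes> x"
      using commutes_with_generate [OF that(1) U] U comm by (metis subsetD)
  qed
  show "comm_group ?C"
    by (rule group.group_comm_groupI [OF group_subgroup_generated]) (simp add: com C)
  show "U \<subseteq> carrier ?C" unfolding C by (auto intro: generate.incl)
  fix x assume "x \<in> carrier ?C"
  then have "x \<in> generate G U" by (simp add: C)
  then show "x [^] k = \<one>"
  proof (induction rule: generate.induct)
    case (inv h)
    then show ?case using U tors by (simp add: int_pow_inv subsetD)
  next
    case (eng x y)
    then have "x \<in> carrier G" "y \<in> carrier G" "x \<otimes> y = y \<otimes> x"
      using generate_in_carrier [OF U] com by auto
    then show ?case using eng.IH by (simp add: int_pow_mult_distrib)
  qed (use tors in auto)
qed

text \<open>The ordered product does not refer to the commutative subgroup, whereas the product over a set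
  can only be formed inside one. Every commutative subgroup containing the factors may be used, so
  different simplices can be treated in different subgroups.\<close>

lemma row_product_eq_finprod:
  assumes "comm_group (subgroup_generated G U)" "distinct vs"
    and e: "\<And>v. v \<in> set vs \<Longrightarrow> e v \<in> carrier (subgroup_generated G U)"
  shows "row_product G e n vs
    = finprod (subgroup_generated G U) (\<lambda>v. e v [^]\<^bsub>subgroup_generated G U\<^esub> n v) (set vs)"
proof -
  interpret C: comm_group "subgroup_generated G U" by fact
  show ?thesis
    using assms(2) e
  proof (induction vs)
    case Nil
    show ?case by (simp add: row_product_def)
  next
    case (Cons v vs)
    then have "e v [^]\<^bsub>subgroup_generated G U\<^esub> n v = e v [^] n v"
      by (simp add: int_pow_subgroup_generated)
    moreover have "(\<Otimes>\<^bsub>subgroup_generated G U\<^esub>w\<in>insert v (set vs). e w [^]\<^bsub>subgroup_generated G U\<^esub> n w)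
        = e v [^]\<^bsub>subgroup_generated G U\<^esub> n v \<otimes>\<^bsub>subgroup_generated G U\<^esub>
          (\<Otimes>\<^bsub>subgroup_generated G U\<^esub>w\<in>set vs. e w [^]\<^bsub>subgroup_generated G U\<^esub> n w)"
      using Cons.prems by (intro C.finprod_insert) (auto intro!: C.int_pow_closed)
    ultimately show ?case using Cons by (simp add: row_product_def)
  qed
qed

lemma row_product_closed:
  "(\<And>v. v \<in> set vs \<Longrightarrow> e v \<in> carrier G) \<Longrightarrow> row_product G e n vs \<in> carrier G"
  unfolding row_product_def by (rule list_prod_closed) auto

lemma int_pow_cong_mod:
  assumes "x \<in> carrier G" "x [^] (d :: int) = \<one>" "m mod d = n mod d"
  shows "x [^] m = x [^] n"
proof -
  obtain q where "m = n + d * q"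
    using assms(3) by (metis mod_eqE add.commute add_diff_cancel_left' diff_add_cancel mod_eq_dvd_iff dvd_def)
  then show ?thesis
    using assms(1,2) by (simp add: int_pow_mult int_pow_pow [symmetric])
qed

end

lemma hom_row_product:
  assumes h: "h \<in> hom G H" "group G" "group H" and "\<And>v. v \<in> set vs \<Longrightarrow> e v \<in> carrier G"
  shows "h (row_product G e n vs) = row_product H (\<lambda>v. h (e v)) n vs"
proof -
  interpret group_hom G H h using h by (simp add: group_hom_def group_hom_axioms_def)
  show ?thesis
    using assms(4)
  proof (induction vs)
    case Nil
    show ?case by (simp add: row_product_def)
  next
    case (Cons v vs)
    then have "row_product G e n vs \<in> carrier G" by (intro G.row_product_closed) auto
    with Cons show ?case by (simp add: row_product_def hom_int_pow)
  qed
qed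

section \<open>The linear system of a simplicial set\<close>

context group
begin

lemma int_pow_commute:
  assumes "x \<in> carrier G" "z \<in> carrier G" "x \<otimes> z = z \<otimes> x"
  shows "x [^] (k :: int) \<otimes> z = z \<otimes> x [^] k"
proof -
  have "z \<otimes> x [^] k = x [^] k \<otimes> z"
  proof (rule commutes_with_generate [where U = "{x}"])
    show "x [^] k \<in> generate G {x}"
      using assms(1) by (auto simp: generate_pow)
  qed (use assms in auto)
  then show ?thesis by simp
qed

text \<open>Here \<open>a\<close>, \<open>b\<close>, \<open>c\<close> are the faces \<open>d\<^sub>0\<close>, \<open>d\<^sub>1\<close>, \<open>d\<^sub>2\<close> of a 2-simplex and \<open>n\<close> is its row of \<open>A\<^sub>X\<close>.
  The exponents of coinciding faces add up, possibly to \<open>0\<close> modulo \<open>d\<close>; since the values commute and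
  have exponent \<open>d\<close>, the product over the support is still the alternating product of the faces.\<close>

lemma row_product_three_faces:
  assumes y: "\<And>x. x \<in> {a, b, c} \<Longrightarrow> y x \<in> carrier G \<and> y x [^] int d = \<one>"
    and comm: "\<And>x x'. x \<in> {a, b, c} \<Longrightarrow> x' \<in> {a, b, c} \<Longrightarrow> y x \<otimes> y x' = y x' \<otimes> y x"
    and n: "\<And>x. n x = ((if x = a then 1 else 0) - (if x = b then 1 else 0)
      + (if x = c then 1 else 0)) mod int d"
    and vs: "distinct vs" "set vs = {x \<in> {a, b, c}. n x \<noteq> 0}"
  shows "row_product G y n vs = y c \<otimes> y a \<otimes> inv (y b)"
proof -
  let ?U = "y ` {a, b, c}"
  define C where "C = subgroup_generated G ?U"
  have U: "?U \<subseteq> carrier G" using y by auto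
  have commU: "x \<otimes> x' = x' \<otimes> x" if "x \<in> ?U" "x' \<in> ?U" for x x'
    using that by (elim imageE) (simp only: comm)
  have torsU: "x [^] int d = \<one>" if "x \<in> ?U" for x
    using that by (elim imageE) (simp only: y)
  note C = commuting_subgroup [OF U commU torsU, folded C_def]
  interpret C: comm_group C by (rule C(1))
  have yC: "y a \<in> carrier C" "y b \<in> carrier C" "y c \<in> carrier C"
    using C(2) by auto
  have pow: "x [^]\<^bsub>C\<^esub> k = x [^] k" if "x \<in> carrier C" for x and k :: int
    using that unfolding C_def by (rule int_pow_subgroup_generated)
  have inv: "inv\<^bsub>C\<^esub> x = inv x" if "x \<in> carrier C" for x
    using that unfolding C_def by (rule inv_subgroup_generated)
  have mult: "monoid.mult C = monoid.mult G" and one: "\<one>\<^bsub>C\<^esub> = \<one>"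
    by (simp_all add: C_def)
  let ?m = "\<lambda>x. (if x = a then 1 else 0) - (if x = b then 1 else 0) + (if x = c then 1 else 0) :: int"
  have nm: "y x [^]\<^bsub>C\<^esub> n x = y x [^]\<^bsub>C\<^esub> ?m x" if "x \<in> {a, b, c}" for x
  proof (rule C.int_pow_cong_mod)
    show "y x \<in> carrier C" using that yC by auto
    then show "y x [^]\<^bsub>C\<^esub> int d = \<one>\<^bsub>C\<^esub>" using y [OF that] by (simp add: pow one)
  qed (simp add: n)
  have "row_product G y n vs = (\<Otimes>\<^bsub>C\<^esub>x\<in>set vs. y x [^]\<^bsub>C\<^esub> n x)"
    unfolding C_def
    by (rule row_product_eq_finprod) (use C vs in \<open>auto simp: C_def\<close>)
  also have "\<dots> = (\<Otimes>\<^bsub>C\<^esub>x\<in>{a, b, c}. y x [^]\<^bsub>C\<^esub> ?m x)"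
  proof (rule C.finprod_mono_neutral_cong_left)
    show "y x [^]\<^bsub>C\<^esub> ?m x = \<one>\<^bsub>C\<^esub>" if x: "x \<in> {a, b, c} - set vs" for x
    proof -
      from x have "n x = 0" unfolding vs(2) by blast
      with x nm [of x] show "y x [^]\<^bsub>C\<^esub> ?m x = \<one>\<^bsub>C\<^esub>" by (simp only: int_pow_0 Diff_iff)
    qed
    show "y x [^]\<^bsub>C\<^esub> n x = y x [^]\<^bsub>C\<^esub> ?m x" if "x \<in> set vs" for x
      using nm that unfolding vs(2) by blast
    show "(\<lambda>x. y x [^]\<^bsub>C\<^esub> ?m x) \<in> {a, b, c} \<rightarrow> carrier C"
      using yC by (intro Pi_I C.int_pow_closed) blast
  qed (use vs(2) in auto)
  also have "\<dots> = y c \<otimes>\<^bsub>C\<^esub> y a \<otimes>\<^bsub>C\<^esub> inv\<^bsub>C\<^esub> y b"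
  proof -
    consider "a = b" "b = c" | "a = b" "b \<noteq> c" | "a = c" "b \<noteq> c" | "b = c" "a \<noteq> b"
      | "a \<noteq> b" "b \<noteq> c" "a \<noteq> c" by blast
    then show ?thesis
    proof cases
      case 2
      have "y b \<otimes>\<^bsub>C\<^esub> (y c \<otimes>\<^bsub>C\<^esub> inv\<^bsub>C\<^esub> y b) = y c"
        using yC C.m_lcomm [of "y b" "y c" "inv\<^bsub>C\<^esub> y b"] by simp
      with 2 yC show ?thesis by (simp add: Pi_iff C.m_ac)
    next
      case 3
      have "{a, b, c} = {b, c}" using 3 by auto
      moreover have "y c [^]\<^bsub>C\<^esub> (2 :: int) = y c \<otimes>\<^bsub>C\<^esub> y c"
        using yC C.int_pow_mult [of "y c" 1 1] by simp
      ultimately show ?thesis using 3 yC by (simp add: Pi_iff C.int_pow_neg C.m_ac)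
    qed (use yC in \<open>simp_all add: Pi_iff C.int_pow_neg C.m_ac\<close>)
  qed
  also have "\<dots> = y c \<otimes> y a \<otimes> inv (y b)"
    using yC by (simp add: inv mult)
  finally show ?thesis .
qed

end

lemma atMost_2_faces: "{i. i \<le> (2::nat) \<and> P i} = {i \<in> {0, 1, 2}. P i}"
  by auto

lemma mat_system_of:
  "mat (system_of d X \<gamma>) \<sigma> x = ((if x = face X 2 0 \<sigma> then 1 else 0)
    - (if x = face X 2 1 \<sigma> then 1 else 0) + (if x = face X 2 2 \<sigma> then 1 else 0)) mod int d"
proof -
  have "(\<Sum>i \<in> {i. i \<le> 2 \<and> face X 2 i \<sigma> = x}. (- 1) ^ i)
      = (\<Sum>i \<in> {0, 1, 2 :: nat}. if face X 2 i \<sigma> = x then (- 1 :: int) ^ i else 0)"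
    unfolding atMost_2_faces by (rule sum.inter_filter) simp
  also have "\<dots> = (if x = face X 2 0 \<sigma> then 1 else 0)
    - (if x = face X 2 1 \<sigma> then 1 else 0) + (if x = face X 2 2 \<sigma> then 1 else 0)"
    by auto
  finally show ?thesis by (simp add: system_of_def)
qed

lemma row_supp_system_of:
  assumes "simplicial_set X" "\<sigma> \<in> simp X 2"
  shows "row_supp (system_of d X \<gamma>) \<sigma>
    = {x \<in> {face X 2 0 \<sigma>, face X 2 1 \<sigma>, face X 2 2 \<sigma>}. mat (system_of d X \<gamma>) \<sigma> x \<noteq> 0}"
proof -
  have "{face X 2 0 \<sigma>, face X 2 1 \<sigma>, face X 2 2 \<sigma>} \<subseteq> simp X 1"
    using simplicial_set_face [OF assms(1), of \<sigma> 1] assms(2) by (simp add: numeral_2_eq_2)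
  moreover have "cols (system_of d X \<gamma>) = simp X 1" by (simp add: system_of_def)
  ultimately show ?thesis by (auto simp: row_supp_def mat_system_of split: if_splits)
qed

lemma linear_system_system_of:
  assumes "simplicial_set X" "0 < d"
  shows "linear_system d (system_of d X \<gamma>)"
proof -
  have "finite (row_supp (system_of d X \<gamma>) \<sigma>)" if "\<sigma> \<in> simp X 2" for \<sigma>
    unfolding row_supp_system_of [OF assms(1) that] by simp
  then show ?thesis
    using assms(2) by (simp add: linear_system_def system_of_def carrier_integer_mod_group)
qed

text \<open>When faces of \<open>\<sigma>\<close> coincide, a coefficient may vanish modulo \<open>d\<close>, and then the commutation
  relations of the row of \<open>\<sigma>\<close> do not cover all faces. In that case the support is a single face
  with coefficient \<open>1\<close>, whose value is a power of \<open>j\<close> by the row itself, and the remaining faces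
  coincide. So the values at the faces of \<open>\<sigma>\<close> commute in all cases, and the row says that \<open>y\<close> is
  multiplicative on \<open>\<sigma>\<close> up to the factor \<open>j [^] (- \<gamma> \<sigma>)\<close>.\<close>

lemma operator_solution_system_of:
  fixes y :: "'x \<Rightarrow> 'a"
  assumes "group G" "simplicial_set X" "1 < d"
  shows "operator_solution d (system_of d X \<gamma>) G j y \<longleftrightarrow>
    j \<in> carrier G \<and> j [^]\<^bsub>G\<^esub> int d = \<one>\<^bsub>G\<^esub> \<and>
    (\<forall>x\<in>simp X 1. y x \<in> carrier G \<and> y x [^]\<^bsub>G\<^esub> int d = \<one>\<^bsub>G\<^esub> \<and> j \<otimes>\<^bsub>G\<^esub> y x = y x \<otimes>\<^bsub>G\<^esub> j) \<and>
    (\<forall>\<sigma>\<in>simp X 2.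
       (\<forall>i\<le>2. \<forall>k\<le>2. y (face X 2 i \<sigma>) \<otimes>\<^bsub>G\<^esub> y (face X 2 k \<sigma>) = y (face X 2 k \<sigma>) \<otimes>\<^bsub>G\<^esub> y (face X 2 i \<sigma>)) \<and>
       y (face X 2 2 \<sigma>) \<otimes>\<^bsub>G\<^esub> y (face X 2 0 \<sigma>) = j [^]\<^bsub>G\<^esub> (- \<gamma> \<sigma>) \<otimes>\<^bsub>G\<^esub> y (face X 2 1 \<sigma>))"
    (is "?sol \<longleftrightarrow> ?j \<and> ?jd \<and> ?y \<and> ?r")
proof -
  interpret group G by fact
  let ?L = "system_of d X \<gamma>"
  have cols: "cols ?L = simp X 1" and rows: "rows ?L = simp X 2"
    and rhs: "rhs ?L \<sigma> = (- \<gamma> \<sigma>) mod int d" for \<sigma>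
    by (simp_all add: system_of_def)
  have row: "(\<forall>v\<in>row_supp ?L \<sigma>. \<forall>w\<in>row_supp ?L \<sigma>. y v \<otimes>\<^bsub>G\<^esub> y w = y w \<otimes>\<^bsub>G\<^esub> y v) \<and>
      (\<forall>vs. distinct vs \<longrightarrow> set vs = row_supp ?L \<sigma>
         \<longrightarrow> row_product G y (mat ?L \<sigma>) vs = j [^]\<^bsub>G\<^esub> rhs ?L \<sigma>) \<longleftrightarrow>
      (\<forall>i\<le>2. \<forall>k\<le>2. y (face X 2 i \<sigma>) \<otimes>\<^bsub>G\<^esub> y (face X 2 k \<sigma>) = y (face X 2 k \<sigma>) \<otimes>\<^bsub>G\<^esub> y (face X 2 i \<sigma>)) \<and>
       y (face X 2 2 \<sigma>) \<otimes>\<^bsub>G\<^esub> y (face X 2 0 \<sigma>) = j [^]\<^bsub>G\<^esub> (- \<gamma> \<sigma>) \<otimes>\<^bsub>G\<^esub> y (face X 2 1 \<sigma>)"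
    (is "?comm \<and> ?prod \<longleftrightarrow> ?comm' \<and> ?prod'")
    if "\<sigma> \<in> simp X 2" ?j ?jd ?y for \<sigma>
  proof -
    define a b c where abc: "a = face X 2 0 \<sigma>" "b = face X 2 1 \<sigma>" "c = face X 2 2 \<sigma>"
    let ?n = "mat ?L \<sigma>"
    have n: "?n x = ((if x = a then 1 else 0) - (if x = b then 1 else 0)
      + (if x = c then 1 else 0)) mod int d" for x
      unfolding abc by (rule mat_system_of)
    have supp: "row_supp ?L \<sigma> = {x \<in> {a, b, c}. ?n x \<noteq> 0}"
      unfolding abc by (rule row_supp_system_of [OF assms(2) that(1)])
    have "a \<in> simp X 1" "b \<in> simp X 1" "c \<in> simp X 1"
      using simplicial_set_face [OF assms(2), of \<sigma> 1] that(1) by (simp_all add: abc numeral_2_eq_2)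
    with that(4) have y: "y x \<in> carrier G" "y x [^]\<^bsub>G\<^esub> int d = \<one>\<^bsub>G\<^esub>" "j \<otimes>\<^bsub>G\<^esub> y x = y x \<otimes>\<^bsub>G\<^esub> j"
      if "x \<in> {a, b, c}" for x using that by auto
    have le2: "i \<le> 2 \<longleftrightarrow> i = 0 \<or> i = 1 \<or> i = (2::nat)" for i by auto
    have comm': "?comm' \<longleftrightarrow> (\<forall>x\<in>{a, b, c}. \<forall>x'\<in>{a, b, c}. y x \<otimes>\<^bsub>G\<^esub> y x' = y x' \<otimes>\<^bsub>G\<^esub> y x)"
      by (auto simp: abc le2)
    have rhs': "j [^]\<^bsub>G\<^esub> rhs ?L \<sigma> = j [^]\<^bsub>G\<^esub> (- \<gamma> \<sigma>)"
      unfolding rhs by (rule int_pow_cong_mod [where d = "int d"]) (use that in simp_all)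
    have prod: "?prod \<longleftrightarrow> ?prod'" if c': ?comm'
    proof -
      have yy: "y x \<in> carrier G \<and> y x [^]\<^bsub>G\<^esub> int d = \<one>\<^bsub>G\<^esub>" if "x \<in> {a, b, c}" for x
        using y(1,2) [OF that] by simp
      have cab: "y x \<otimes>\<^bsub>G\<^esub> y x' = y x' \<otimes>\<^bsub>G\<^esub> y x" if "x \<in> {a, b, c}" "x' \<in> {a, b, c}" for x x'
        by (rule bspec [OF bspec [OF c' [unfolded comm'] that(1)] that(2)])
      obtain vs where vs: "distinct vs" "set vs = row_supp ?L \<sigma>"
        using finite_distinct_list [of "row_supp ?L \<sigma>"] unfolding supp by auto
      have "row_product G y ?n vs = y c \<otimes>\<^bsub>G\<^esub> y a \<otimes>\<^bsub>G\<^esub> inv\<^bsub>G\<^esub> y b"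
        if "distinct vs" "set vs = row_supp ?L \<sigma>" for vs
        by (rule row_product_three_faces [OF yy cab n that(1) that(2) [unfolded supp]])
      moreover have "y c \<otimes>\<^bsub>G\<^esub> y a \<otimes>\<^bsub>G\<^esub> inv\<^bsub>G\<^esub> y b = j [^]\<^bsub>G\<^esub> (- \<gamma> \<sigma>) \<longleftrightarrow>
          y c \<otimes>\<^bsub>G\<^esub> y a = j [^]\<^bsub>G\<^esub> (- \<gamma> \<sigma>) \<otimes>\<^bsub>G\<^esub> y b"
        using y(1) \<open>?j\<close> inv_solve_right [of "j [^]\<^bsub>G\<^esub> (- \<gamma> \<sigma>)" "y c \<otimes>\<^bsub>G\<^esub> y a" "y b"] by auto
      ultimately show ?thesis using vs unfolding rhs' abc by metis
    qed
    have "?comm'" if c: ?comm and p: ?prod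
    proof (cases "\<exists>x\<in>{a, b, c}. ?n x = 0")
      case False
      then show ?thesis using c unfolding comm' supp by blast
    next
      case True
      \<comment> \<open>Two equal faces cancel if they enter with opposite signs; with equal signs they add up to
        the coefficient \<open>2\<close>, which vanishes only for \<open>d = 2\<close>.\<close>
      have two: "(2 :: int) mod int d = 0 \<Longrightarrow> d = 2"
        using \<open>1 < d\<close> by (cases "d = 2") (auto simp: mod_pos_pos_trivial)
      have one: "1 mod int d = 1" using \<open>1 < d\<close> by simp
      have m1: "- 1 mod int d = 0 \<longleftrightarrow> False" "- 1 mod (2 :: int) = 1"
        using \<open>1 < d\<close> by (auto simp: zmod_minus1)
      have "(a = b \<and> b \<noteq> c) \<or> (a = c \<and> b \<noteq> c \<and> d = 2) \<or> (b = c \<and> a \<noteq> b)"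
      proof (rule ccontr)
        assume "\<not> ?thesis"
        then consider "a = b" "b = c" | "a = c" "b \<noteq> c" "d \<noteq> 2" | "a \<noteq> b" "b \<noteq> c" "a \<noteq> c"
          by blast
        then have "?n a \<noteq> 0 \<and> ?n b \<noteq> 0 \<and> ?n c \<noteq> 0"
          by cases (use one two m1(1) in \<open>auto simp: n\<close>)
        with True show False by blast
      qed
      then consider "a = b" "b \<noteq> c" | "a = c" "b \<noteq> c" "d = 2" | "b = c" "a \<noteq> b"
        by blast
      then obtain x z where xz: "{a, b, c} = {x, z}" "?n x = 1" "?n z = 0"
      proof cases
        case 1
        then have "{a, b, c} = {c, a}" "?n c = 1" "?n a = 0" using one by (auto simp: n)
        then show ?thesis by (rule that)
      next
        case 2
        then have "{a, b, c} = {b, a}" "?n b = 1" "?n a = 0" using m1(2) n [of b] n [of a] by auto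
        then show ?thesis by (rule that)
      next
        case 3
        then have "{a, b, c} = {a, b}" "?n a = 1" "?n b = 0" using one by (auto simp: n)
        then show ?thesis by (rule that)
      qed
      have "set [x] = row_supp ?L \<sigma>" using xz unfolding supp by auto
      with p have "row_product G y ?n [x] = j [^]\<^bsub>G\<^esub> rhs ?L \<sigma>" by auto
      then have "y x = j [^]\<^bsub>G\<^esub> rhs ?L \<sigma>"
        using xz y(1) [of x] by (simp add: row_product_def)
      then have "y x \<otimes>\<^bsub>G\<^esub> y z = y z \<otimes>\<^bsub>G\<^esub> y x"
        using int_pow_commute [of j "y z"] y(1,3) [of z] xz \<open>?j\<close> by simp
      then show ?thesis unfolding comm' xz by auto
    qed
    moreover have ?comm if ?comm'
      using that unfolding comm' supp by blast
    ultimately show ?thesis using prod by blast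
  qed
  show ?thesis
  proof (cases "?j \<and> ?jd \<and> ?y")
    case True
    then show ?thesis
      using row unfolding operator_solution_def cols rows by blast
  next
    case False
    then show ?thesis unfolding operator_solution_def cols by blast
  qed
qed

section \<open>The quotient of the simplicial set of a linear system\<close>

lemma face_collapse_map:
  assumes "simplicial_subset Y X" "i \<le> Suc n"
  shows "face (collapse X Y) (Suc n) i (collapse_map Y (Suc n) x)
    = collapse_map Y n (face X (Suc n) i x)"
  using assms by (auto simp: collapse_def collapse_map_def simplicial_subset_def)

lemma simp_collapse:
  "simp (collapse X Y) n = insert None (collapse_map Y n ` simp X n)"
  by (auto simp: collapse_def collapse_map_def image_iff)

lemma simp_N_complex_1:
  "[s] \<in> simp (N_complex d L) 1 \<longleftrightarrow> s \<in> carrier (fun_group d L) \<and> fun_supp L s \<in> complex_of L"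
  by (simp add: N_complex_def nerve_def del: carrier_product_group)

lemma simp_N_complex_2:
  "[s, t] \<in> simp (N_complex d L) 2 \<longleftrightarrow> s \<in> carrier (fun_group d L) \<and>
    t \<in> carrier (fun_group d L) \<and> fun_supp L s \<union> fun_supp L t \<in> complex_of L"
  by (auto simp: N_complex_def nerve_def simp del: carrier_product_group)

lemma simp_N_complex_1E:
  assumes "x \<in> simp (N_complex d L) 1"
  obtains s where "x = [s]" "[s] \<in> simp (N_complex d L) 1"
proof -
  have "length x = 1" using assms by (simp add: N_complex_def nerve_def)
  then obtain s where "x = [s]" by (auto simp: length_Suc_conv)
  with assms that show ?thesis by simp
qed

lemma simp_N_complex_2E:
  assumes "x \<in> simp (N_complex d L) 2"
  obtains s t where "x = [s, t]" "[s, t] \<in> simp (N_complex d L) 2"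
proof -
  have "length x = 2" using assms by (simp add: N_complex_def nerve_def)
  then obtain s t where "x = [s, t]" by (auto simp: length_Suc_conv numeral_2_eq_2)
  with assms that show ?thesis by simp
qed

lemma simp_N_wedge_1:
  "[s] \<in> simp (N_wedge d L) 1 \<longleftrightarrow>
    s = \<one>\<^bsub>fun_group d L\<^esub> \<or> (\<exists>i\<in>rows L. s \<in> carrier (row_group d L i))"
  by (simp add: N_wedge_def nerve_def del: one_product_group)

lemma simp_N_wedge_2:
  "[s, t] \<in> simp (N_wedge d L) 2 \<longleftrightarrow> s = \<one>\<^bsub>fun_group d L\<^esub> \<and> t = \<one>\<^bsub>fun_group d L\<^esub> \<or>
    (\<exists>i\<in>rows L. s \<in> carrier (row_group d L i) \<and> t \<in> carrier (row_group d L i))"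
  by (simp add: N_wedge_def nerve_def numeral_2_eq_2 del: one_product_group)

text \<open>The images in the quotient of the simplices \<open>(s)\<close> and \<open>(s, t)\<close> of \<open>N(\<int>\<^sub>d, \<Sigma>)\<close>. Every simplex of the
  quotient in dimensions 1 and 2 is of this form, the collapsed point included.\<close>

definition edge :: "nat \<Rightarrow> ('r, 'c) lin_sys \<Rightarrow> ('c \<Rightarrow> int) \<Rightarrow> ('c \<Rightarrow> int) list option"
  where "edge d L s = collapse_map (N_wedge d L) 1 [s]"

definition triangle ::
    "nat \<Rightarrow> ('r, 'c) lin_sys \<Rightarrow> ('c \<Rightarrow> int) \<Rightarrow> ('c \<Rightarrow> int) \<Rightarrow> ('c \<Rightarrow> int) list option"
  where "triangle d L s t = collapse_map (N_wedge d L) 2 [s, t]"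

lemma unit_simp_N_complex:
  "[\<one>\<^bsub>fun_group d L\<^esub>] \<in> simp (N_complex d L) 1"
  "[\<one>\<^bsub>fun_group d L\<^esub>, \<one>\<^bsub>fun_group d L\<^esub>] \<in> simp (N_complex d L) 2"
proof -
  have "fun_supp L \<one>\<^bsub>fun_group d L\<^esub> = {}" by (auto simp: fun_supp_def)
  moreover have "\<one>\<^bsub>fun_group d L\<^esub> \<in> carrier (fun_group d L)"
    by (rule monoid.one_closed [OF group.is_monoid [OF group_fun_group]])
  moreover have "{} \<in> complex_of L" by (simp add: complex_of_def)
  ultimately show "[\<one>\<^bsub>fun_group d L\<^esub>] \<in> simp (N_complex d L) 1"
    "[\<one>\<^bsub>fun_group d L\<^esub>, \<one>\<^bsub>fun_group d L\<^esub>] \<in> simp (N_complex d L) 2"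
    unfolding simp_N_complex_1 simp_N_complex_2 by simp_all
qed

lemma edge_unit [simp]: "edge d L \<one>\<^bsub>fun_group d L\<^esub> = None"
  using simp_N_wedge_1 [of "\<one>\<^bsub>fun_group d L\<^esub>" d L] by (simp add: collapse_map_def edge_def)

lemma simp_N_bar_1: "simp (N_bar d L) 1 = {edge d L s | s. [s] \<in> simp (N_complex d L) 1}"
proof -
  have "None \<in> {edge d L s | s. [s] \<in> simp (N_complex d L) 1}"
    using unit_simp_N_complex(1) edge_unit by (metis (mono_tags, lifting) mem_Collect_eq)
  moreover have "collapse_map (N_wedge d L) 1 ` simp (N_complex d L) 1
      = {edge d L s | s. [s] \<in> simp (N_complex d L) 1}"
  proof (intro equalityI subsetI)
    fix v assume "v \<in> collapse_map (N_wedge d L) 1 ` simp (N_complex d L) 1"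
    then obtain x where x: "v = collapse_map (N_wedge d L) 1 x" "x \<in> simp (N_complex d L) 1" ..
    from x(2) show "v \<in> {edge d L s | s. [s] \<in> simp (N_complex d L) 1}"
      by (rule simp_N_complex_1E) (use x(1) in \<open>auto simp: edge_def\<close>)
  qed (auto simp: edge_def)
  ultimately show ?thesis
    unfolding N_bar_def simp_collapse by blast
qed

lemma simp_N_bar_2: "simp (N_bar d L) 2 = {triangle d L s t | s t. [s, t] \<in> simp (N_complex d L) 2}"
proof -
  have "triangle d L \<one>\<^bsub>fun_group d L\<^esub> \<one>\<^bsub>fun_group d L\<^esub> = None"
    using simp_N_wedge_2 [of "\<one>\<^bsub>fun_group d L\<^esub>" "\<one>\<^bsub>fun_group d L\<^esub>" d L]
    by (simp add: collapse_map_def triangle_def)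
  then have "None \<in> {triangle d L s t | s t. [s, t] \<in> simp (N_complex d L) 2}"
    using unit_simp_N_complex(2) by (metis (mono_tags, lifting) mem_Collect_eq)
  moreover have "collapse_map (N_wedge d L) 2 ` simp (N_complex d L) 2
      = {triangle d L s t | s t. [s, t] \<in> simp (N_complex d L) 2}"
  proof (intro equalityI subsetI)
    fix \<sigma> assume "\<sigma> \<in> collapse_map (N_wedge d L) 2 ` simp (N_complex d L) 2"
    then obtain x where x: "\<sigma> = collapse_map (N_wedge d L) 2 x" "x \<in> simp (N_complex d L) 2" ..
    from x(2) show "\<sigma> \<in> {triangle d L s t | s t. [s, t] \<in> simp (N_complex d L) 2}"
      by (rule simp_N_complex_2E) (use x(1) in \<open>auto simp: triangle_def\<close>)
  qed (auto simp: triangle_def)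
  ultimately show ?thesis
    unfolding N_bar_def simp_collapse by blast
qed

lemma face_N_bar_2:
  "face (N_bar d L) 2 0 (triangle d L s t) = edge d L t"
  "face (N_bar d L) 2 1 (triangle d L s t) = edge d L (s \<otimes>\<^bsub>fun_group d L\<^esub> t)"
  "face (N_bar d L) 2 2 (triangle d L s t) = edge d L s"
proof -
  have "face (N_bar d L) 2 i (triangle d L s t)
      = collapse_map (N_wedge d L) 1 (face (nerve (fun_group d L)) 2 i [s, t])" if "i \<le> 2" for i
    using that face_collapse_map [OF simplicial_subset_N_wedge, of i 1 d L "[s, t]"]
    by (simp add: N_bar_def N_complex_def triangle_def numeral_2_eq_2)
  then show "face (N_bar d L) 2 0 (triangle d L s t) = edge d L t"
    "face (N_bar d L) 2 1 (triangle d L s t) = edge d L (s \<otimes>\<^bsub>fun_group d L\<^esub> t)"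
    "face (N_bar d L) 2 2 (triangle d L s t) = edge d L s"
    by (simp_all add: nerve_def edge_def del: mult_product_group)
qed

section \<open>The cocycle as a coboundary upstairs\<close>

lemma fun_group_nat_pow:
  assumes "v \<in> cols L"
  shows "(s [^]\<^bsub>fun_group d L\<^esub> (n :: nat)) v = (int n * s v) mod int d"
  using assms by (induction n) (simp_all add: mod_simps algebra_simps)

lemma fun_group_exponent:
  assumes "s \<in> carrier (fun_group d L)"
  shows "s [^]\<^bsub>fun_group d L\<^esub> int d = \<one>\<^bsub>fun_group d L\<^esub>"
proof -
  have closed: "s [^]\<^bsub>fun_group d L\<^esub> d \<in> carrier (fun_group d L)"
    by (rule monoid.nat_pow_closed [OF group.is_monoid [OF group_fun_group] assms])
  have "s [^]\<^bsub>fun_group d L\<^esub> d = \<one>\<^bsub>fun_group d L\<^esub>"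
  proof (rule extensionalityI [where A = "cols L"])
    show "s [^]\<^bsub>fun_group d L\<^esub> d \<in> extensional (cols L)"
      using closed by (simp add: PiE_iff)
  qed (simp_all add: fun_group_nat_pow)
  then show ?thesis by (simp only: int_pow_int)
qed

lemma row_in_fun_group:
  "linear_system d L \<Longrightarrow> i \<in> rows L \<Longrightarrow> row L i \<in> carrier (fun_group d L)"
  by (simp add: row_def linear_system_def)

lemma carrier_row_group:
  assumes "linear_system d L" "i \<in> rows L"
  shows "carrier (row_group d L i) = range (\<lambda>a :: int. row L i [^]\<^bsub>fun_group d L\<^esub> a)"
  unfolding row_group_def
  by (rule group.carrier_subgroup_generated_by_singleton [OF group_fun_group row_in_fun_group])
    (rule assms)+

lemma row_pow_mod:
  assumes "linear_system d L" "i \<in> rows L"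
  shows "row L i [^]\<^bsub>fun_group d L\<^esub> (a mod int d) = row L i [^]\<^bsub>fun_group d L\<^esub> a"
  by (rule group.int_pow_cong_mod [OF group_fun_group _ fun_group_exponent])
    (use row_in_fun_group [OF assms] in simp_all)

text \<open>The line generated by a row has \<open>d\<close> elements, so the multiple is determined modulo \<open>d\<close>.\<close>

lemma row_pow_inj:
  assumes "linear_system d L" "standing_assumptions d L" "0 < d" "i \<in> rows L"
    and eq: "row L i [^]\<^bsub>fun_group d L\<^esub> a = row L i [^]\<^bsub>fun_group d L\<^esub> a'"
  shows "a mod int d = a' mod int d"
proof -
  let ?p = "\<lambda>a :: int. row L i [^]\<^bsub>fun_group d L\<^esub> a"
  have "range ?p = ?p ` {0..<int d}"
  proof -
    have "?p a \<in> ?p ` {0..<int d}" for a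
      using row_pow_mod [OF assms(1,4), of a] assms(3)
      by (intro image_eqI [of _ _ "a mod int d"]) simp_all
    then show ?thesis by blast
  qed
  then have c: "carrier (row_group d L i) = ?p ` {0..<int d}"
    using carrier_row_group [OF assms(1,4)] by simp
  have "row_group d L i \<cong> integer_mod_group d"
    using assms(2,4) by (simp add: standing_assumptions_def)
  from iso_same_card [OF this] have "card (?p ` {0..<int d}) = card {0..<int d}"
    using assms(3) by (simp add: c carrier_integer_mod_group)
  then have "inj_on ?p {0..<int d}" by (intro eq_card_imp_inj_on) simp_all
  moreover have "?p (a mod int d) = ?p (a' mod int d)"
    using eq row_pow_mod [OF assms(1,4)] by simp
  ultimately show ?thesis using assms(3) by (auto dest: inj_onD)
qed

text \<open>Multiples of different rows agree only if they are zero, and multiples of the same row only if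
  the factors agree modulo \<open>d\<close>. Hence the value \<open>a b\<^sub>i\<close> does not depend on how the function is
  written as \<open>a A\<^sub>i\<close>.\<close>

lemma b_tilde_row_pow:
  assumes "linear_system d L" "standing_assumptions d L" "0 < d" "i \<in> rows L"
  shows "b_tilde d L [row L i [^]\<^bsub>fun_group d L\<^esub> (a :: int)] = (a * rhs L i) mod int d"
proof -
  let ?G = "fun_group d L" and ?s = "row L i [^]\<^bsub>fun_group d L\<^esub> a"
  let ?P = "\<lambda>z. \<exists>i\<in>rows L. \<exists>a\<in>carrier (integer_mod_group d).
      [?s] = [row L i [^]\<^bsub>?G\<^esub> a] \<and> z = (a * rhs L i) mod int d"
  have mem: "?s \<in> carrier (row_group d L i)"
    using carrier_row_group [OF assms(1,4)] by simp
  have "fun_supp L ?s \<in> complex_of L"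
    unfolding complex_of_def using row_group_carrier [OF mem] assms(4) by blast
  then have N: "[?s] \<in> simp (N_complex d L) 1"
    using row_group_carrier [OF mem] unfolding simp_N_complex_1 by blast
  have a: "a mod int d \<in> carrier (integer_mod_group d)"
    using assms(3) by (simp add: carrier_integer_mod_group)
  have ex: "?P ((a * rhs L i) mod int d)"
    using a assms(4) row_pow_mod [OF assms(1,4), of a]
    by (intro bexI [of _ i] bexI [of _ "a mod int d"]) (simp_all add: mod_mult_left_eq)
  have uniq: "z = (a * rhs L i) mod int d" if "?P z" for z
  proof -
    obtain k a' where k: "k \<in> rows L" "?s = row L k [^]\<^bsub>?G\<^esub> a'" "z = (a' * rhs L k) mod int d"
      using \<open>?P z\<close> by auto
    show ?thesis
    proof (cases "k = i")
      case True
      then have "a mod int d = a' mod int d"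
        using row_pow_inj [OF assms] k(2) by blast
      then show ?thesis using k(3) True by (metis mod_mult_left_eq)
    next
      case False
      have "?s \<in> carrier (row_group d L k)"
        using carrier_row_group [OF assms(1) k(1)] k(2) by simp
      then have "?s = \<one>\<^bsub>?G\<^esub>"
        using mem assms(2,4) k(1) False unfolding standing_assumptions_def by blast
      then have "a mod int d = 0 mod int d" "a' mod int d = 0 mod int d"
        using row_pow_inj [OF assms, of a 0] row_pow_inj [OF assms(1-3) k(1), of a' 0] k(2)
        by (simp_all del: one_product_group)
      then show ?thesis using k(3) by (metis mod_mult_left_eq mult_zero_left)
    qed
  qed
  have "(THE z. ?P z) = (a * rhs L i) mod int d"
    using ex uniq by (rule the_equality)
  moreover have "\<exists>i\<in>rows L. \<exists>a\<in>carrier (integer_mod_group d). [?s] = [row L i [^]\<^bsub>?G\<^esub> a]"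
    using ex by blast
  ultimately show ?thesis
    using N by (simp only: b_tilde_def restrict_apply' if_True)
qed

lemma b_tilde_unit:
  assumes "linear_system d L" "standing_assumptions d L" "0 < d"
  shows "b_tilde d L [\<one>\<^bsub>fun_group d L\<^esub>] = 0"
proof (cases "rows L = {}")
  case True
  then show ?thesis using unit_simp_N_complex(1) [where d = d and L = L]
    by (simp add: b_tilde_def del: one_product_group)
next
  case False
  then obtain i where "i \<in> rows L" by blast
  from b_tilde_row_pow [OF assms this, of 0] show ?thesis
    by (simp del: one_product_group)
qed

text \<open>Also on the collapsed 2-simplices \<open>\<gamma>\<^sub>b\<close> is the coboundary of \<open>b\<close>-tilde, because the latter is additive
  on each line \<open>\<langle>A\<^sub>i\<rangle>\<close>.\<close>

lemma gamma_b_triangle: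
  assumes "linear_system d L" "standing_assumptions d L" "0 < d"
    and N: "[s, t] \<in> simp (N_complex d L) 2"
  shows "gamma_b d L (triangle d L s t) =
    (b_tilde d L [s] + b_tilde d L [t] - b_tilde d L [s \<otimes>\<^bsub>fun_group d L\<^esub> t]) mod int d"
proof (cases "[s, t] \<in> simp (N_wedge d L) 2")
  case True
  interpret F: group "fun_group d L" by (rule group_fun_group)
  have "gamma_b d L (triangle d L s t) = 0"
    using True by (simp add: collapse_map_def triangle_def gamma_b_def N_bar_def collapse_def)
  moreover have "(b_tilde d L [s] + b_tilde d L [t] - b_tilde d L [s \<otimes>\<^bsub>fun_group d L\<^esub> t]) mod int d = 0"
  proof -
    consider "s = \<one>\<^bsub>fun_group d L\<^esub>" "t = \<one>\<^bsub>fun_group d L\<^esub>"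
      | i where "i \<in> rows L" "s \<in> carrier (row_group d L i)" "t \<in> carrier (row_group d L i)"
      using True unfolding simp_N_wedge_2 by blast
    then show ?thesis
    proof cases
      case 1
      then have "s \<otimes>\<^bsub>fun_group d L\<^esub> t = \<one>\<^bsub>fun_group d L\<^esub>" by (simp only: F.l_one F.one_closed)
      then show ?thesis using 1 b_tilde_unit [OF assms(1-3)] by (simp del: one_product_group mult_product_group)
    next
      case 2
      obtain a a' :: int where st: "s = row L i [^]\<^bsub>fun_group d L\<^esub> a"
        "t = row L i [^]\<^bsub>fun_group d L\<^esub> a'"
        using 2 carrier_row_group [OF assms(1)] by blast
      have "s \<otimes>\<^bsub>fun_group d L\<^esub> t = row L i [^]\<^bsub>fun_group d L\<^esub> (a + a')"
        unfolding st by (rule F.int_pow_mult [symmetric, OF row_in_fun_group [OF assms(1) 2(1)]])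
      then have "b_tilde d L [s \<otimes>\<^bsub>fun_group d L\<^esub> t] = ((a + a') * rhs L i) mod int d"
        by (simp only: b_tilde_row_pow [OF assms(1-3) 2(1)])
      moreover have "(p mod m + q mod m - (p + q) mod m) mod m = 0" for p q m :: int
      proof -
        have "(p mod m + q mod m - (p + q) mod m) mod m
            = ((p mod m + q mod m) mod m - (p + q) mod m mod m) mod m"
          by (rule mod_diff_eq [symmetric])
        then show ?thesis by (simp only: mod_add_eq mod_mod_trivial diff_self mod_0)
      qed
      ultimately show ?thesis
        by (simp only: st b_tilde_row_pow [OF assms(1-3) 2(1)] distrib_right)
    qed
  qed
  ultimately show ?thesis by simp
next
  case False
  then have Some: "triangle d L s t = Some [s, t]"
    by (simp add: collapse_map_def triangle_def)
  then have "Some [s, t] \<in> simp (N_bar d L) 2"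
    using N unfolding simp_N_bar_2 by force
  then show ?thesis unfolding Some by (rule gamma_b_Some)
qed

lemma cohomologous_differ_by_coboundary:
  assumes "simplicial_set X" "\<gamma> \<in> carrier (cochain_group d X 2)" "0 < d"
    and "cohomology_class d X 2 \<gamma> = cohomology_class d X 2 \<gamma>'"
  obtains f where "\<And>\<sigma>. \<sigma> \<in> simp X 2 \<Longrightarrow> \<gamma> \<sigma> mod int d
    = (\<gamma>' \<sigma> + f (face X 2 0 \<sigma>) - f (face X 2 1 \<sigma>) + f (face X 2 2 \<sigma>)) mod int d"
proof -
  let ?B = "coboundaries d X 2" and ?C = "cochain_group d X 2"
  interpret C: group ?C by (simp add: cochain_group_def)
  have B: "?B = coboundary d X 1 ` carrier (cochain_group d X 1)"
    by (simp add: coboundaries_def numeral_2_eq_2)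
  define z where "z = (\<lambda>x\<in>simp X 1. 0 :: int)"
  have "z \<in> carrier (cochain_group d X 1)"
    by (simp add: z_def cochain_group_def)
  moreover have "coboundary d X 1 z \<otimes>\<^bsub>?C\<^esub> \<gamma> = \<gamma>"
  proof (rule extensionalityI [where A = "simp X 2"])
    show "\<gamma> \<in> extensional (simp X 2)" using assms(2) by (simp add: cochain_group_def PiE_iff)
    fix \<sigma> assume \<sigma>: "\<sigma> \<in> simp X 2"
    have "coboundary d X 1 z \<sigma> = 0"
      using \<sigma> simplicial_set_face [OF assms(1), of \<sigma> 1]
      by (simp add: coboundary_def z_def numeral_2_eq_2)
    moreover have "\<gamma> \<sigma> \<in> {0..<int d}"
      using \<sigma> assms(2,3) by (auto simp: cochain_group_def carrier_integer_mod_group)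
    ultimately show "(coboundary d X 1 z \<otimes>\<^bsub>?C\<^esub> \<gamma>) \<sigma> = \<gamma> \<sigma>"
      using \<sigma> by (simp add: cochain_group_def)
  qed (simp add: cochain_group_def)
  ultimately have "\<gamma> \<in> ?B #>\<^bsub>?C\<^esub> \<gamma>" unfolding B r_coset_def by force
  then have "\<gamma> \<in> ?B #>\<^bsub>?C\<^esub> \<gamma>'" using assms(4) by (simp add: cohomology_class_def)
  then obtain f where f: "\<gamma> = coboundary d X 1 f \<otimes>\<^bsub>?C\<^esub> \<gamma>'"
    unfolding B r_coset_def by blast
  have "\<gamma> \<sigma> mod int d = (\<gamma>' \<sigma> + f (face X 2 0 \<sigma>) - f (face X 2 1 \<sigma>) + f (face X 2 2 \<sigma>)) mod int d"
    if "\<sigma> \<in> simp X 2" for \<sigma>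
  proof -
    have "\<gamma> \<sigma> = (coboundary d X 1 f \<sigma> + \<gamma>' \<sigma>) mod int d"
      using that by (subst f) (simp add: cochain_group_def)
    then show ?thesis
      using that by (simp add: coboundary_def numeral_2_eq_2 mod_simps algebra_simps)
  qed
  then show ?thesis by (rule that)
qed

lemma edge_eq_None_iff:
  assumes "linear_system d L"
  shows "edge d L s = None \<longleftrightarrow> s = \<one>\<^bsub>fun_group d L\<^esub> \<or>
    (\<exists>i\<in>rows L. \<exists>a :: int. s = row L i [^]\<^bsub>fun_group d L\<^esub> a)"
proof -
  have "edge d L s = None \<longleftrightarrow> [s] \<in> simp (N_wedge d L) 1"
    by (simp add: edge_def collapse_map_def)
  moreover have "(\<exists>i\<in>rows L. s \<in> carrier (row_group d L i))
      \<longleftrightarrow> (\<exists>i\<in>rows L. \<exists>a :: int. s = row L i [^]\<^bsub>fun_group d L\<^esub> a)"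
    by (rule bex_cong [OF HOL.refl]) (auto simp: carrier_row_group [OF assms])
  ultimately show ?thesis by (simp only: simp_N_wedge_1)
qed

text \<open>If \<open>\<gamma> = \<gamma>\<^sub>b + \<delta>f\<close> on the quotient, then the pullback of \<open>\<gamma>\<close> to \<open>N(\<int>\<^sub>d, \<Sigma>)\<close> is the coboundary of
  \<open>\<beta>\<close>, the sum of \<open>b\<close>-tilde and the pullback of \<open>f\<close>. The latter is constant on the collapsed lines
  \<open>\<langle>A\<^sub>i\<rangle>\<close>, and \<open>\<beta> 0\<close> is this constant.\<close>

lemma cocycle_lift:
  assumes "linear_system d L" "standing_assumptions d L" "0 < d"
    and "\<gamma> \<in> cocycles d (N_bar d L) 2"
    and "cohomology_class d (N_bar d L) 2 \<gamma> = cohomology_class d (N_bar d L) 2 (gamma_b d L)"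
  obtains \<beta> where
    "\<And>s t. [s, t] \<in> simp (N_complex d L) 2 \<Longrightarrow> \<gamma> (triangle d L s t) mod int d
      = (\<beta> s + \<beta> t - \<beta> (s \<otimes>\<^bsub>fun_group d L\<^esub> t)) mod int d"
    "\<And>i a. i \<in> rows L \<Longrightarrow> \<beta> (row L i [^]\<^bsub>fun_group d L\<^esub> (a :: int)) mod int d
      = (a * rhs L i + \<beta> \<one>\<^bsub>fun_group d L\<^esub>) mod int d"
proof -
  have "\<gamma> \<in> carrier (cochain_group d (N_bar d L) 2)" using assms(4) by (simp add: cocycles_def)
  from cohomologous_differ_by_coboundary [OF simplicial_set_N_bar this assms(3,5)]
  obtain f where f: "\<And>\<sigma>. \<sigma> \<in> simp (N_bar d L) 2 \<Longrightarrow> \<gamma> \<sigma> mod int d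
    = (gamma_b d L \<sigma> + f (face (N_bar d L) 2 0 \<sigma>) - f (face (N_bar d L) 2 1 \<sigma>)
      + f (face (N_bar d L) 2 2 \<sigma>)) mod int d" by blast
  define \<beta> where "\<beta> s = b_tilde d L [s] + f (edge d L s)" for s
  show ?thesis
  proof (rule that)
    fix s t assume N: "[s, t] \<in> simp (N_complex d L) 2"
    let ?b = "b_tilde d L [s] + b_tilde d L [t] - b_tilde d L [s \<otimes>\<^bsub>fun_group d L\<^esub> t]"
    let ?f = "f (edge d L t) - f (edge d L (s \<otimes>\<^bsub>fun_group d L\<^esub> t)) + f (edge d L s)"
    have "triangle d L s t \<in> simp (N_bar d L) 2" using N unfolding simp_N_bar_2 by blast
    from f [OF this] have "\<gamma> (triangle d L s t) mod int d = (?b mod int d + ?f) mod int d"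
      by (simp only: face_N_bar_2 gamma_b_triangle [OF assms(1-3) N] algebra_simps)
    also have "\<dots> = (?b + ?f) mod int d" by (rule mod_add_left_eq)
    finally show "\<gamma> (triangle d L s t) mod int d
      = (\<beta> s + \<beta> t - \<beta> (s \<otimes>\<^bsub>fun_group d L\<^esub> t)) mod int d"
      by (simp only: \<beta>_def algebra_simps)
  next
    fix i and a :: int assume i: "i \<in> rows L"
    have "edge d L (row L i [^]\<^bsub>fun_group d L\<^esub> a) = edge d L \<one>\<^bsub>fun_group d L\<^esub>"
      using edge_eq_None_iff [OF assms(1)] i by (metis edge_unit)
    then show "\<beta> (row L i [^]\<^bsub>fun_group d L\<^esub> a) mod int d
      = (a * rhs L i + \<beta> \<one>\<^bsub>fun_group d L\<^esub>) mod int d"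
      by (simp only: \<beta>_def b_tilde_row_pow [OF assms(1-3) i] b_tilde_unit [OF assms(1-3)]
          add_0 mod_add_left_eq)
  qed
qed

section \<open>Maps that are multiplicative on simplices\<close>

text \<open>Partial representations of the function group: a product is only prescribed for functions whose
  supports lie in a common simplex. They mediate between the solutions of the two systems.\<close>

definition simplexwise_hom ::
    "nat \<Rightarrow> ('r, 'c) lin_sys \<Rightarrow> ('a, 'm) monoid_scheme \<Rightarrow> 'a \<Rightarrow> (('c \<Rightarrow> int) \<Rightarrow> 'a) \<Rightarrow> bool"
  where "simplexwise_hom d L G j T \<longleftrightarrow>
    j \<in> carrier G \<and> j [^]\<^bsub>G\<^esub> int d = \<one>\<^bsub>G\<^esub> \<and>
    (\<forall>s. [s] \<in> simp (N_complex d L) 1 \<longrightarrow> T s \<in> carrier G \<and> j \<otimes>\<^bsub>G\<^esub> T s = T s \<otimes>\<^bsub>G\<^esub> j) \<and>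
    (\<forall>s t. [s, t] \<in> simp (N_complex d L) 2 \<longrightarrow> T s \<otimes>\<^bsub>G\<^esub> T t = T (s \<otimes>\<^bsub>fun_group d L\<^esub> t)) \<and>
    (\<forall>i\<in>rows L. T (row L i) = j [^]\<^bsub>G\<^esub> rhs L i)"

lemma simplexwise_homD:
  assumes "simplexwise_hom d L G j T"
  shows "j \<in> carrier G" "j [^]\<^bsub>G\<^esub> int d = \<one>\<^bsub>G\<^esub>"
    "[s] \<in> simp (N_complex d L) 1 \<Longrightarrow> T s \<in> carrier G"
    "[s] \<in> simp (N_complex d L) 1 \<Longrightarrow> j \<otimes>\<^bsub>G\<^esub> T s = T s \<otimes>\<^bsub>G\<^esub> j"
    "[s, t] \<in> simp (N_complex d L) 2 \<Longrightarrow> T s \<otimes>\<^bsub>G\<^esub> T t = T (s \<otimes>\<^bsub>fun_group d L\<^esub> t)"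
    "i \<in> rows L \<Longrightarrow> T (row L i) = j [^]\<^bsub>G\<^esub> rhs L i"
  using assms by (simp_all only: simplexwise_hom_def)

lemma fun_group_comm: "s \<otimes>\<^bsub>fun_group d L\<^esub> t = t \<otimes>\<^bsub>fun_group d L\<^esub> s"
  by (simp add: add.commute)

lemma fun_supp_pow: "fun_supp L (s [^]\<^bsub>fun_group d L\<^esub> (n :: nat)) \<subseteq> fun_supp L s"
  by (auto simp: fun_supp_def fun_group_nat_pow)

lemma simp_N_complex_1I:
  "s \<in> carrier (fun_group d L) \<Longrightarrow> fun_supp L s \<subseteq> \<sigma> \<Longrightarrow> \<sigma> \<in> complex_of L
    \<Longrightarrow> [s] \<in> simp (N_complex d L) 1"
  unfolding simp_N_complex_1 by (blast intro: complex_of_mono)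

lemma simp_N_complex_2I:
  "s \<in> carrier (fun_group d L) \<Longrightarrow> t \<in> carrier (fun_group d L) \<Longrightarrow> fun_supp L s \<subseteq> \<sigma>
    \<Longrightarrow> fun_supp L t \<subseteq> \<sigma> \<Longrightarrow> \<sigma> \<in> complex_of L \<Longrightarrow> [s, t] \<in> simp (N_complex d L) 2"
  unfolding simp_N_complex_2 by (blast intro: complex_of_mono)

lemma fun_group_mult_closed:
  "s \<in> carrier (fun_group d L) \<Longrightarrow> t \<in> carrier (fun_group d L)
    \<Longrightarrow> s \<otimes>\<^bsub>fun_group d L\<^esub> t \<in> carrier (fun_group d L)"
  by (rule monoid.m_closed [OF group.is_monoid [OF group_fun_group]])

lemma fun_group_pow_closed:
  "s \<in> carrier (fun_group d L) \<Longrightarrow> s [^]\<^bsub>fun_group d L\<^esub> (n :: nat) \<in> carrier (fun_group d L)"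
  by (rule monoid.nat_pow_closed [OF group.is_monoid [OF group_fun_group]])

lemma fun_group_one_closed: "\<one>\<^bsub>fun_group d L\<^esub> \<in> carrier (fun_group d L)"
  by (rule monoid.one_closed [OF group.is_monoid [OF group_fun_group]])

lemma fun_supp_row: "fun_supp L (row L i) = row_supp L i"
  by (auto simp: fun_supp_def row_supp_def row_def)

lemma row_supp_complex: "i \<in> rows L \<Longrightarrow> row_supp L i \<in> complex_of L"
  by (auto simp: complex_of_def)

lemma row_simp_N_complex:
  "linear_system d L \<Longrightarrow> i \<in> rows L \<Longrightarrow> [row L i] \<in> simp (N_complex d L) 1"
  by (rule simp_N_complex_1I [OF row_in_fun_group _ row_supp_complex]) (simp_all add: fun_supp_row)

context
  fixes d :: nat and L :: "('r, 'c) lin_sys" and G :: "('a, 'm) monoid_scheme" and j T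
  assumes group: "group G" and T: "simplexwise_hom d L G j T"
begin

interpretation group G by (rule group)

lemma simplexwise_hom_one: "T \<one>\<^bsub>fun_group d L\<^esub> = \<one>\<^bsub>G\<^esub>"
proof -
  let ?e = "\<one>\<^bsub>fun_group d L\<^esub>"
  have "?e \<otimes>\<^bsub>fun_group d L\<^esub> ?e = ?e"
    by (rule monoid.l_one [OF group.is_monoid [OF group_fun_group] fun_group_one_closed])
  then have "T ?e \<otimes>\<^bsub>G\<^esub> T ?e = T ?e"
    using simplexwise_homD(5) [OF T unit_simp_N_complex(2)] by (simp only:)
  then show ?thesis
    using simplexwise_homD(3) [OF T unit_simp_N_complex(1)] by (metis l_cancel_one)
qed

lemma simplexwise_hom_pow:
  assumes "[s] \<in> simp (N_complex d L) 1"
  shows "T (s [^]\<^bsub>fun_group d L\<^esub> (n :: nat)) = T s [^]\<^bsub>G\<^esub> n"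
proof (induction n)
  case 0
  show ?case using simplexwise_hom_one by (simp del: one_product_group)
next
  case (Suc n)
  have s: "s \<in> carrier (fun_group d L)" "fun_supp L s \<in> complex_of L"
    using assms by (simp_all only: simp_N_complex_1)
  have "[s [^]\<^bsub>fun_group d L\<^esub> n, s] \<in> simp (N_complex d L) 2"
    by (rule simp_N_complex_2I [OF fun_group_pow_closed [OF s(1)] s(1) fun_supp_pow order_refl s(2)])
  from simplexwise_homD(5) [OF T this] Suc.IH show ?case
    by (simp del: mult_product_group)
qed

lemma simplexwise_hom_commute:
  assumes "[s, t] \<in> simp (N_complex d L) 2"
  shows "T s \<otimes>\<^bsub>G\<^esub> T t = T t \<otimes>\<^bsub>G\<^esub> T s"
proof -
  have "[t, s] \<in> simp (N_complex d L) 2"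
    using assms unfolding simp_N_complex_2 by (simp only: Un_commute simp_thms)
  from simplexwise_homD(5) [OF T this] simplexwise_homD(5) [OF T assms] show ?thesis
    by (simp only: fun_group_comm)
qed

lemma simplexwise_hom_exponent:
  assumes "[s] \<in> simp (N_complex d L) 1"
  shows "T s [^]\<^bsub>G\<^esub> int d = \<one>\<^bsub>G\<^esub>"
proof -
  have "s [^]\<^bsub>fun_group d L\<^esub> d = \<one>\<^bsub>fun_group d L\<^esub>"
    using fun_group_exponent [of s L d] assms by (simp only: int_pow_int simp_N_complex_1)
  then show ?thesis
    using simplexwise_hom_pow [OF assms, of d] simplexwise_hom_one by (simp only: int_pow_int)
qed

lemma simplexwise_hom_row_pow:
  assumes "linear_system d L" "0 < d" "i \<in> rows L"
  shows "T (row L i [^]\<^bsub>fun_group d L\<^esub> (a :: int)) = j [^]\<^bsub>G\<^esub> (a * rhs L i)"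
proof -
  note j = simplexwise_homD(1,2) [OF T]
  define n where "n = nat (a mod int d)"
  have n: "int n = a mod int d" using assms(2) by (simp add: n_def)
  have "row L i [^]\<^bsub>fun_group d L\<^esub> a = row L i [^]\<^bsub>fun_group d L\<^esub> n"
    using row_pow_mod [OF assms(1,3), of a] by (simp only: n [symmetric] int_pow_int)
  then have "T (row L i [^]\<^bsub>fun_group d L\<^esub> a) = T (row L i) [^]\<^bsub>G\<^esub> int n"
    using simplexwise_hom_pow [OF row_simp_N_complex [OF assms(1,3)]] by (simp only: int_pow_int)
  also have "\<dots> = j [^]\<^bsub>G\<^esub> (rhs L i * int n)"
    using j by (simp only: simplexwise_homD(6) [OF T assms(3)] int_pow_pow)
  also have "\<dots> = j [^]\<^bsub>G\<^esub> (a * rhs L i)"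
    by (rule int_pow_cong_mod [OF j]) (simp add: n mod_mult_right_eq mult.commute)
  finally show ?thesis .
qed

end

section \<open>Solutions are maps multiplicative on simplices\<close>

definition unit_fun :: "('r, 'c) lin_sys \<Rightarrow> 'c \<Rightarrow> 'c \<Rightarrow> int"
  where "unit_fun L v = (\<lambda>w\<in>cols L. if w = v then 1 else 0)"

lemma unit_fun_closed: "1 < d \<Longrightarrow> unit_fun L v \<in> carrier (fun_group d L)"
  by (simp add: unit_fun_def carrier_integer_mod_group)

lemma fun_supp_unit_fun: "v \<in> cols L \<Longrightarrow> fun_supp L (unit_fun L v) = {v}"
  by (auto simp: fun_supp_def unit_fun_def)

lemma unit_fun_simp:
  assumes "1 < d" "v \<in> cols L"
  shows "[unit_fun L v] \<in> simp (N_complex d L) 1"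
proof -
  have "{v} \<in> complex_of L" using assms(2) by (auto simp: complex_of_def)
  then show ?thesis
    using fun_supp_unit_fun [OF assms(2)] unit_fun_closed [OF assms(1), of L v]
    unfolding simp_N_complex_1 by simp
qed

text \<open>A function is the sum of its multiples of unit functions, and all partial sums are supported in
  the support of the function, which is a simplex; so multiplicativity applies to each step.\<close>

lemma simplexwise_hom_eq_row_product:
  assumes G: "group G" and T: "simplexwise_hom d L G j T" and d: "1 < d"
    and s: "[s] \<in> simp (N_complex d L) 1" and vs: "distinct vs" "set vs = fun_supp L s"
  shows "T s = row_product G (\<lambda>v. T (unit_fun L v)) s vs"
proof -
  interpret group G by (rule G)
  have sc: "s \<in> carrier (fun_group d L)" and sK: "fun_supp L s \<in> complex_of L"
    using s by (simp_all only: simp_N_complex_1)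
  have s_range: "0 \<le> s v" "s v < int d" if "v \<in> cols L" for v
    using sc that d by (auto simp: PiE_iff carrier_integer_mod_group)
  define part where "part ws = (\<lambda>w\<in>cols L. if w \<in> set ws then s w else 0)" for ws
  have part_closed: "part ws \<in> carrier (fun_group d L)" for ws
    using s_range d by (simp add: part_def carrier_integer_mod_group)
  have part_supp: "fun_supp L (part ws) \<subseteq> set ws" for ws
    by (auto simp: part_def fun_supp_def)
  have "T (part ws) = row_product G (\<lambda>v. T (unit_fun L v)) s ws"
    if "distinct ws" "set ws \<subseteq> fun_supp L s" for ws
    using that
  proof (induction ws)
    case Nil
    have "part [] = \<one>\<^bsub>fun_group d L\<^esub>" by (simp add: part_def)
    then show ?case using simplexwise_hom_one [OF G T] by (simp only: row_product_def list.map list_prod_simps)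
  next
    case (Cons v ws)
    have v: "v \<in> cols L" "v \<notin> set ws" "set ws \<subseteq> fun_supp L s" "v \<in> fun_supp L s"
      using Cons.prems by (auto simp: fun_supp_def)
    let ?u = "unit_fun L v [^]\<^bsub>fun_group d L\<^esub> nat (s v)"
    have split: "part (v # ws) = ?u \<otimes>\<^bsub>fun_group d L\<^esub> part ws"
    proof (rule extensionalityI [where A = "cols L"])
      fix w assume w: "w \<in> cols L"
      then show "part (v # ws) w = (?u \<otimes>\<^bsub>fun_group d L\<^esub> part ws) w"
        using v s_range [OF w] d
        by (auto simp: part_def fun_group_nat_pow unit_fun_def)
    qed (simp_all add: part_def)
    have "[?u, part ws] \<in> simp (N_complex d L) 2"
    proof (rule simp_N_complex_2I [OF fun_group_pow_closed [OF unit_fun_closed [OF d]] part_closed _ _ sK])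
      show "fun_supp L ?u \<subseteq> fun_supp L s"
        by (rule order_trans [OF fun_supp_pow]) (simp add: fun_supp_unit_fun [OF v(1)] v(4))
      show "fun_supp L (part ws) \<subseteq> fun_supp L s"
        using part_supp v(3) by blast
    qed
    from simplexwise_homD(5) [OF T this] split
    have "T (part (v # ws)) = T ?u \<otimes>\<^bsub>G\<^esub> T (part ws)" by (simp only:)
    also have "T ?u = T (unit_fun L v) [^]\<^bsub>G\<^esub> s v"
      using simplexwise_hom_pow [OF G T unit_fun_simp [OF d v(1)], of "nat (s v)"] s_range [OF v(1)]
        int_pow_int [of G "T (unit_fun L v)" "nat (s v)"] by (simp only: int_nat_eq if_True)
    finally show ?case
      using Cons.IH Cons.prems by (simp add: row_product_def)
  qed
  from this [OF vs(1)] vs(2) have "T (part vs) = row_product G (\<lambda>v. T (unit_fun L v)) s vs"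
    by simp
  moreover have "part vs = s"
  proof (rule extensionalityI [where A = "cols L"])
    show "s \<in> extensional (cols L)" using sc by (simp add: PiE_iff)
  qed (auto simp: part_def vs(2) fun_supp_def)
  ultimately show ?thesis by simp
qed

lemma operator_solution_of_simplexwise_hom:
  assumes G: "group G" and T: "simplexwise_hom d L G j T" and d: "1 < d" and L: "linear_system d L"
  shows "operator_solution d L G j (\<lambda>v. T (unit_fun L v))"
proof -
  note TD = simplexwise_homD [OF T] and U = unit_fun_simp [OF d]
  have comm: "T (unit_fun L v) \<otimes>\<^bsub>G\<^esub> T (unit_fun L w) = T (unit_fun L w) \<otimes>\<^bsub>G\<^esub> T (unit_fun L v)"
    if "i \<in> rows L" "v \<in> row_supp L i" "w \<in> row_supp L i" for i v w
  proof (rule simplexwise_hom_commute [OF G T])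
    show "[unit_fun L v, unit_fun L w] \<in> simp (N_complex d L) 2"
      by (rule simp_N_complex_2I [OF unit_fun_closed [OF d] unit_fun_closed [OF d] _ _
            row_supp_complex [OF that(1)]])
        (use that in \<open>auto simp: fun_supp_unit_fun row_supp_def\<close>)
  qed
  have row: "row_product G (\<lambda>v. T (unit_fun L v)) (mat L i) vs = j [^]\<^bsub>G\<^esub> rhs L i"
    if i: "i \<in> rows L" and vs: "distinct vs" "set vs = row_supp L i" for i vs
  proof -
    have "row_product G (\<lambda>v. T (unit_fun L v)) (mat L i) vs
        = row_product G (\<lambda>v. T (unit_fun L v)) (row L i) vs"
      unfolding row_product_def
      by (rule arg_cong [where f = "list_prod G"], rule map_cong)
        (auto simp: vs(2) row_supp_def row_def)
    also have "\<dots> = T (row L i)"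
      by (rule simplexwise_hom_eq_row_product [OF G T d row_simp_N_complex [OF L i], symmetric])
        (simp_all add: vs fun_supp_row)
    finally show ?thesis using TD(6) [OF i] by simp
  qed
  show ?thesis
    unfolding operator_solution_def
    by (intro conjI ballI allI impI TD(1,2) TD(3) [OF U] TD(4) [OF U] comm row
        simplexwise_hom_exponent [OF G T U])
qed

text \<open>The chosen enumeration of the support is immaterial when the support is a simplex, because then
  the factors commute.\<close>

definition extend_solution ::
    "('r, 'c) lin_sys \<Rightarrow> ('a, 'm) monoid_scheme \<Rightarrow> ('c \<Rightarrow> 'a) \<Rightarrow> ('c \<Rightarrow> int) \<Rightarrow> 'a"
  where "extend_solution L G e s
    = row_product G e s (SOME vs. distinct vs \<and> set vs = fun_supp L s)"

text \<open>All computations within one simplex \<open>\<sigma>\<close> take place in the commutative group generated by \<open>j\<close> and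
  the \<open>e v\<close> with \<open>v \<in> \<sigma>\<close>. There the value at \<open>s\<close> can be written as a product over the whole of \<open>\<sigma>\<close>,
  which makes it comparable for different functions supported in \<open>\<sigma>\<close>.\<close>

lemma extend_solution_properties:
  fixes L :: "('r, 'c) lin_sys" and e :: "'c \<Rightarrow> 'a"
  assumes "group G" "linear_system d L" "operator_solution d L G j e" "\<sigma> \<in> complex_of L"
  defines "C \<equiv> subgroup_generated G (insert j (e ` \<sigma>))"
  shows "comm_group C" "\<And>x. x \<in> carrier C \<Longrightarrow> x [^]\<^bsub>G\<^esub> int d = \<one>\<^bsub>G\<^esub>" "j \<in> carrier C"
    "\<And>v. v \<in> \<sigma> \<Longrightarrow> e v \<in> carrier C"
    "\<And>s vs. distinct vs \<Longrightarrow> set vs = fun_supp L s \<Longrightarrow> fun_supp L s \<subseteq> \<sigma> \<Longrightarrow>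
      row_product G e s vs = (\<Otimes>\<^bsub>C\<^esub>v\<in>\<sigma>. e v [^]\<^bsub>C\<^esub> s v)"
    "\<And>s. fun_supp L s \<subseteq> \<sigma> \<Longrightarrow> extend_solution L G e s = (\<Otimes>\<^bsub>C\<^esub>v\<in>\<sigma>. e v [^]\<^bsub>C\<^esub> s v)"
proof -
  interpret group G by (rule assms(1))
  note sol = operator_solutionD [OF assms(3)]
  have sub: "\<sigma> \<subseteq> cols L" by (rule complex_of_subset_cols [OF assms(4)])
  have fin: "finite \<sigma>" by (rule finite_complex_of [OF assms(2,4)])
  let ?U = "insert j (e ` \<sigma>)"
  have U: "?U \<subseteq> carrier G" using sol(1,3) sub by auto
  have torsU: "x [^]\<^bsub>G\<^esub> int d = \<one>\<^bsub>G\<^esub>" if "x \<in> ?U" for x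
    using that sol(2,4) sub by auto
  note cs = commuting_subgroup [OF U operator_solution_commute [OF assms(3,4)] torsU, folded C_def]
  show C: "comm_group C" "\<And>x. x \<in> carrier C \<Longrightarrow> x [^]\<^bsub>G\<^esub> int d = \<one>\<^bsub>G\<^esub>" using cs(1,3) by simp_all
  show j: "j \<in> carrier C" and e: "\<And>v. v \<in> \<sigma> \<Longrightarrow> e v \<in> carrier C" using cs(2) by auto
  interpret C: comm_group C by (rule C)
  show prod: "row_product G e s vs = (\<Otimes>\<^bsub>C\<^esub>v\<in>\<sigma>. e v [^]\<^bsub>C\<^esub> s v)"
    if "distinct vs" "set vs = fun_supp L s" "fun_supp L s \<subseteq> \<sigma>" for s vs
  proof -
    have "row_product G e s vs = (\<Otimes>\<^bsub>C\<^esub>v\<in>set vs. e v [^]\<^bsub>C\<^esub> s v)"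
      unfolding C_def
      by (rule row_product_eq_finprod) (use C(1) e that in \<open>auto simp: C_def\<close>)
    also have "\<dots> = (\<Otimes>\<^bsub>C\<^esub>v\<in>\<sigma>. e v [^]\<^bsub>C\<^esub> s v)"
    proof (rule C.finprod_mono_neutral_cong_left [OF fin])
      show "e v [^]\<^bsub>C\<^esub> s v = \<one>\<^bsub>C\<^esub>" if "v \<in> \<sigma> - set vs" for v
      proof -
        have "s v = 0" using that sub \<open>set vs = fun_supp L s\<close> by (auto simp: fun_supp_def)
        then show ?thesis by simp
      qed
    qed (use that e in \<open>auto intro: C.int_pow_closed\<close>)
    finally show ?thesis .
  qed
  show "extend_solution L G e s = (\<Otimes>\<^bsub>C\<^esub>v\<in>\<sigma>. e v [^]\<^bsub>C\<^esub> s v)" if "fun_supp L s \<subseteq> \<sigma>" for s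
  proof -
    have "\<exists>vs. distinct vs \<and> set vs = fun_supp L s"
      using finite_distinct_list [OF finite_subset [OF that fin]] by blast
    from someI_ex [OF this] show ?thesis
      unfolding extend_solution_def using prod that by blast
  qed
qed

lemma extend_solution_eq_row_product:
  assumes "group G" "linear_system d L" "operator_solution d L G j e"
    and "fun_supp L s \<in> complex_of L" "distinct vs" "set vs = fun_supp L s"
  shows "extend_solution L G e s = row_product G e s vs"
  using extend_solution_properties(5) [OF assms(1-4) assms(5,6) order_refl]
    extend_solution_properties(6) [OF assms(1-4) order_refl] by simp

lemma extend_solution_unit_fun:
  assumes "group G" "linear_system d L" "operator_solution d L G j e" "v \<in> cols L"
  shows "extend_solution L G e (unit_fun L v) = e v"
proof -
  interpret group G by (rule assms(1))
  have "extend_solution L G e (unit_fun L v) = row_product G e (unit_fun L v) [v]"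
    by (rule extend_solution_eq_row_product [OF assms(1-3)])
      (use assms(4) in \<open>auto simp: fun_supp_unit_fun complex_of_def\<close>)
  then show ?thesis
    using operator_solutionD(3) [OF assms(3,4)] assms(4) by (simp add: row_product_def unit_fun_def)
qed

lemma simplexwise_hom_extend_solution:
  assumes "group G" "linear_system d L" "operator_solution d L G j e"
  shows "simplexwise_hom d L G j (extend_solution L G e)"
proof -
  interpret group G by (rule assms(1))
  note sol = operator_solutionD [OF assms(3)]
  let ?T = "extend_solution L G e"
  have "?T s \<in> carrier G \<and> j \<otimes>\<^bsub>G\<^esub> ?T s = ?T s \<otimes>\<^bsub>G\<^esub> j"
    if "[s] \<in> simp (N_complex d L) 1" for s
  proof -
    have s: "fun_supp L s \<in> complex_of L" using that by (simp only: simp_N_complex_1)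
    define C where "C = subgroup_generated G (insert j (e ` fun_supp L s))"
    note P = extend_solution_properties [OF assms s, folded C_def]
    interpret C: comm_group C by (rule P)
    have "?T s \<in> carrier C"
      unfolding P(6) [OF order_refl] by (rule C.finprod_closed) (auto intro: C.int_pow_closed P(4))
    moreover have "carrier C \<subseteq> carrier G" "monoid.mult C = monoid.mult G"
      unfolding C_def by (simp_all add: carrier_subgroup_generated_subset)
    ultimately show ?thesis using C.m_comm [OF P(3)] by (metis subsetD)
  qed
  moreover have "?T s \<otimes>\<^bsub>G\<^esub> ?T t = ?T (s \<otimes>\<^bsub>fun_group d L\<^esub> t)"
    if "[s, t] \<in> simp (N_complex d L) 2" for s t
  proof -
    define \<sigma> where "\<sigma> = fun_supp L s \<union> fun_supp L t"
    have \<sigma>: "\<sigma> \<in> complex_of L" using that by (simp only: simp_N_complex_2 \<sigma>_def)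
    define C where "C = subgroup_generated G (insert j (e ` \<sigma>))"
    note P = extend_solution_properties [OF assms \<sigma>, folded C_def]
    interpret C: comm_group C by (rule P)
    have mult: "monoid.mult C = monoid.mult G" and one: "\<one>\<^bsub>C\<^esub> = \<one>\<^bsub>G\<^esub>" by (simp_all add: C_def)
    have pow: "x [^]\<^bsub>C\<^esub> k = x [^]\<^bsub>G\<^esub> k" if "x \<in> carrier C" for x and k :: int
      using that unfolding C_def by (rule int_pow_subgroup_generated)
    have supp: "fun_supp L s \<subseteq> \<sigma>" "fun_supp L t \<subseteq> \<sigma>"
      "fun_supp L (s \<otimes>\<^bsub>fun_group d L\<^esub> t) \<subseteq> \<sigma>"
      unfolding \<sigma>_def by (rule Un_upper1, rule Un_upper2, rule fun_supp_mult)
    have "?T s \<otimes>\<^bsub>C\<^esub> ?T t = (\<Otimes>\<^bsub>C\<^esub>v\<in>\<sigma>. e v [^]\<^bsub>C\<^esub> s v \<otimes>\<^bsub>C\<^esub> e v [^]\<^bsub>C\<^esub> t v)"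
      unfolding P(6) [OF supp(1)] P(6) [OF supp(2)]
      by (rule C.finprod_multf [symmetric]) (auto intro: C.int_pow_closed P(4))
    also have "\<dots> = (\<Otimes>\<^bsub>C\<^esub>v\<in>\<sigma>. e v [^]\<^bsub>C\<^esub> ((s \<otimes>\<^bsub>fun_group d L\<^esub> t) v))"
    proof (rule C.finprod_cong')
      fix v assume v: "v \<in> \<sigma>"
      have ev: "e v \<in> carrier C" by (rule P(4) [OF v])
      have "e v [^]\<^bsub>C\<^esub> s v \<otimes>\<^bsub>C\<^esub> e v [^]\<^bsub>C\<^esub> t v = e v [^]\<^bsub>C\<^esub> (s v + t v)"
        by (rule C.int_pow_mult [OF ev, symmetric])
      also have "\<dots> = e v [^]\<^bsub>C\<^esub> ((s \<otimes>\<^bsub>fun_group d L\<^esub> t) v)"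
      proof (rule C.int_pow_cong_mod [OF ev])
        show "e v [^]\<^bsub>C\<^esub> int d = \<one>\<^bsub>C\<^esub>" using P(2) [OF ev] by (simp add: pow ev one)
        have "v \<in> cols L" using v complex_of_subset_cols [OF \<sigma>] by blast
        then show "(s v + t v) mod int d = ((s \<otimes>\<^bsub>fun_group d L\<^esub> t) v) mod int d" by simp
      qed
      finally show "e v [^]\<^bsub>C\<^esub> s v \<otimes>\<^bsub>C\<^esub> e v [^]\<^bsub>C\<^esub> t v
        = e v [^]\<^bsub>C\<^esub> ((s \<otimes>\<^bsub>fun_group d L\<^esub> t) v)" .
    qed (auto intro: C.int_pow_closed P(4))
    also have "\<dots> = ?T (s \<otimes>\<^bsub>fun_group d L\<^esub> t)"
      by (rule P(6) [OF supp(3), symmetric])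
    finally show ?thesis by (simp only: mult)
  qed
  moreover have "?T (row L i) = j [^]\<^bsub>G\<^esub> rhs L i" if i: "i \<in> rows L" for i
  proof -
    have "finite (row_supp L i)" using assms(2) i by (simp add: linear_system_def)
    then obtain vs where vs: "distinct vs" "set vs = row_supp L i"
      using finite_distinct_list by blast
    have "?T (row L i) = row_product G e (row L i) vs"
      by (rule extend_solution_eq_row_product [OF assms])
        (simp_all add: fun_supp_row vs row_supp_complex i)
    also have "\<dots> = row_product G e (mat L i) vs"
      unfolding row_product_def
      by (rule arg_cong [where f = "list_prod G"], rule map_cong)
        (auto simp: vs(2) row_supp_def row_def)
    also have "\<dots> = j [^]\<^bsub>G\<^esub> rhs L i" by (rule sol(7) [OF i vs])
    finally show ?thesis .
  qed
  ultimately show ?thesis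
    unfolding simplexwise_hom_def using sol(1,2) by blast
qed

section \<open>Twisting by powers of the central generator\<close>

lemma (in group) interchange:
  assumes "a \<in> carrier G" "b \<in> carrier G" "p \<in> carrier G" "q \<in> carrier G" "p \<otimes> b = b \<otimes> p"
  shows "(a \<otimes> p) \<otimes> (b \<otimes> q) = (a \<otimes> b) \<otimes> (p \<otimes> q)"
proof -
  have "(a \<otimes> p) \<otimes> (b \<otimes> q) = a \<otimes> ((p \<otimes> b) \<otimes> q)" using assms(1-4) by (simp add: m_assoc)
  also have "\<dots> = (a \<otimes> b) \<otimes> (p \<otimes> q)" unfolding assms(5) using assms(1-4) by (simp add: m_assoc)
  finally show ?thesis .
qed

lemma (in group) twist_mult:
  assumes "a \<in> carrier G" "b \<in> carrier G" "j \<in> carrier G" "j \<otimes> b = b \<otimes> j"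
  shows "(a \<otimes> j [^] (k :: int)) \<otimes> (b \<otimes> j [^] (l :: int)) = (a \<otimes> b) \<otimes> j [^] (k + l)"
  using assms int_pow_commute [OF assms(3,2,4), of k]
  by (simp add: interchange int_pow_mult)

lemma (in group) twist_properties:
  assumes "a \<in> carrier G" "j \<in> carrier G" "j \<otimes> a = a \<otimes> j"
    and "a [^] int d = \<one>" "j [^] int d = \<one>"
  shows "a \<otimes> j [^] (k :: int) \<in> carrier G" "j \<otimes> (a \<otimes> j [^] k) = (a \<otimes> j [^] k) \<otimes> j"
    "(a \<otimes> j [^] k) [^] int d = \<one>"
proof -
  show "a \<otimes> j [^] k \<in> carrier G" using assms by simp
  have jk: "j [^] k \<otimes> j = j \<otimes> j [^] k" by (rule int_pow_commute) (use assms in simp_all)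
  have "j \<otimes> (a \<otimes> j [^] k) = (j \<otimes> a) \<otimes> j [^] k" using assms(1,2) by (simp add: m_assoc)
  also have "\<dots> = a \<otimes> (j [^] k \<otimes> j)" unfolding assms(3) jk using assms(1,2) by (simp add: m_assoc)
  also have "\<dots> = (a \<otimes> j [^] k) \<otimes> j" using assms(1,2) by (simp add: m_assoc)
  finally show "j \<otimes> (a \<otimes> j [^] k) = (a \<otimes> j [^] k) \<otimes> j" .
  have "a \<otimes> j [^] k = j [^] k \<otimes> a"
    using int_pow_commute [OF assms(2,1,3), of k] by simp
  then have "(a \<otimes> j [^] k) [^] int d = a [^] int d \<otimes> (j [^] k) [^] int d"
    using assms(1,2) by (intro int_pow_mult_distrib int_pow_closed)
  also have "(j [^] k) [^] int d = (j [^] int d) [^] k"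
    using assms(2) by (simp add: int_pow_pow mult.commute)
  finally show "(a \<otimes> j [^] k) [^] int d = \<one>" using assms by simp
qed

text \<open>A cochain \<open>\<gamma>\<close> on the quotient whose pullback is the coboundary of \<open>\<beta>\<close>, where \<open>\<beta>\<close> agrees on the lines
  \<open>\<langle>A\<^sub>i\<rangle>\<close> with \<open>a A\<^sub>i \<mapsto> a b\<^sub>i\<close> up to a constant.\<close>

locale lifted_cocycle =
  fixes d :: nat and L :: "('r, 'c) lin_sys"
    and \<gamma> :: "('c \<Rightarrow> int) list option \<Rightarrow> int" and \<beta> :: "('c \<Rightarrow> int) \<Rightarrow> int"
  assumes d: "1 < d" and lin: "linear_system d L"
    and lift: "[s, t] \<in> simp (N_complex d L) 2 \<Longrightarrow> \<gamma> (triangle d L s t) mod int d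
      = (\<beta> s + \<beta> t - \<beta> (s \<otimes>\<^bsub>fun_group d L\<^esub> t)) mod int d"
    and lift_row: "i \<in> rows L \<Longrightarrow> \<beta> (row L i [^]\<^bsub>fun_group d L\<^esub> (a :: int)) mod int d
      = (a * rhs L i + \<beta> \<one>\<^bsub>fun_group d L\<^esub>) mod int d"
begin

abbreviation X where "X \<equiv> N_bar d L"

abbreviation L\<^sub>X where "L\<^sub>X \<equiv> system_of d X \<gamma>"

lemma operator_solution_N_bar:
  fixes G :: "('a, 'm) monoid_scheme"
  assumes "group G"
  shows "operator_solution d L\<^sub>X G j y \<longleftrightarrow>
    j \<in> carrier G \<and> j [^]\<^bsub>G\<^esub> int d = \<one>\<^bsub>G\<^esub> \<and>
    (\<forall>s. [s] \<in> simp (N_complex d L) 1 \<longrightarrow> y (edge d L s) \<in> carrier G \<and>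
      y (edge d L s) [^]\<^bsub>G\<^esub> int d = \<one>\<^bsub>G\<^esub> \<and> j \<otimes>\<^bsub>G\<^esub> y (edge d L s) = y (edge d L s) \<otimes>\<^bsub>G\<^esub> j) \<and>
    (\<forall>s t. [s, t] \<in> simp (N_complex d L) 2 \<longrightarrow>
      (\<forall>p\<in>{s, t, s \<otimes>\<^bsub>fun_group d L\<^esub> t}. \<forall>q\<in>{s, t, s \<otimes>\<^bsub>fun_group d L\<^esub> t}.
        y (edge d L p) \<otimes>\<^bsub>G\<^esub> y (edge d L q) = y (edge d L q) \<otimes>\<^bsub>G\<^esub> y (edge d L p)) \<and>
      y (edge d L s) \<otimes>\<^bsub>G\<^esub> y (edge d L t)
        = j [^]\<^bsub>G\<^esub> (- \<gamma> (triangle d L s t)) \<otimes>\<^bsub>G\<^esub> y (edge d L (s \<otimes>\<^bsub>fun_group d L\<^esub> t)))"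
proof -
  have le2: "(\<forall>i\<le>2. P i) \<longleftrightarrow> P 2 \<and> P 0 \<and> P (1 :: nat)" for P
    by (auto simp: le_Suc_eq numeral_2_eq_2)
  have Ball_1: "(\<forall>x\<in>simp X 1. P x) \<longleftrightarrow> (\<forall>s. [s] \<in> simp (N_complex d L) 1 \<longrightarrow> P (edge d L s))" for P
    unfolding simp_N_bar_1 by blast
  have Ball_2: "(\<forall>x\<in>simp X 2. P x)
      \<longleftrightarrow> (\<forall>s t. [s, t] \<in> simp (N_complex d L) 2 \<longrightarrow> P (triangle d L s t))" for P
    unfolding simp_N_bar_2 by blast
  show ?thesis
    unfolding operator_solution_system_of [OF assms simplicial_set_N_bar d] Ball_1 Ball_2
    by (simp only: le2 face_N_bar_2 ball_simps simp_thms)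
qed

text \<open>Multiplication by powers of \<open>j\<close> with exponents given by \<open>\<beta>\<close> absorbs the factors \<open>j [^] (- \<gamma> \<sigma>)\<close> in the
  rows of \<open>A\<^sub>X\<close>.\<close>

definition untwist :: "('a, 'm) monoid_scheme \<Rightarrow> 'a \<Rightarrow> (('c \<Rightarrow> int) list option \<Rightarrow> 'a) \<Rightarrow> ('c \<Rightarrow> int) \<Rightarrow> 'a"
  where "untwist G j y s = y (edge d L s) \<otimes>\<^bsub>G\<^esub> j [^]\<^bsub>G\<^esub> \<beta> s"

text \<open>The inverse operation. All edges in the wedge have become the one edge \<open>None\<close>; the zero function
  serves as its representative.\<close>

definition twist :: "('a, 'm) monoid_scheme \<Rightarrow> 'a \<Rightarrow> (('c \<Rightarrow> int) \<Rightarrow> 'a) \<Rightarrow> ('c \<Rightarrow> int) list option \<Rightarrow> 'a"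
  where "twist G j T x = (let s = (case x of None \<Rightarrow> \<one>\<^bsub>fun_group d L\<^esub> | Some xs \<Rightarrow> hd xs)
    in T s \<otimes>\<^bsub>G\<^esub> j [^]\<^bsub>G\<^esub> (- \<beta> s))"

text \<open>Any other representative of the collapsed edge gives the same value: at \<open>a A\<^sub>i\<close> the map \<open>T\<close> has the
  value \<open>j [^] (a b\<^sub>i)\<close>, and this is cancelled by the nonconstant part of \<open>\<beta>\<close>.\<close>

lemma twist_edge:
  assumes "group G" "simplexwise_hom d L G j T" "[s] \<in> simp (N_complex d L) 1"
  shows "twist G j T (edge d L s) = T s \<otimes>\<^bsub>G\<^esub> j [^]\<^bsub>G\<^esub> (- \<beta> s)"
proof (cases "edge d L s = None")
  case False
  then have "edge d L s = Some [s]" by (auto simp: edge_def collapse_map_def)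
  then show ?thesis by (simp add: twist_def)
next
  case True
  interpret group G by fact
  note j = simplexwise_homD(1,2) [OF assms(2)]
  have None: "twist G j T None = j [^]\<^bsub>G\<^esub> (- \<beta> \<one>\<^bsub>fun_group d L\<^esub>)"
    using simplexwise_hom_one [OF assms(1,2)] j by (simp add: twist_def del: one_product_group)
  from True consider "s = \<one>\<^bsub>fun_group d L\<^esub>"
    | i and a :: int where "i \<in> rows L" "s = row L i [^]\<^bsub>fun_group d L\<^esub> a"
    unfolding edge_eq_None_iff [OF lin] by blast
  then show ?thesis
  proof cases
    case 1
    then show ?thesis using j True simplexwise_hom_one [OF assms(1,2)]
      by (simp add: None del: one_product_group)
  next
    case 2
    have "T s \<otimes>\<^bsub>G\<^esub> j [^]\<^bsub>G\<^esub> (- \<beta> s) = j [^]\<^bsub>G\<^esub> (a * rhs L i + - \<beta> s)"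
      using j d simplexwise_hom_row_pow [OF assms(1,2) lin _ 2(1), of a]
      by (simp only: 2(2) int_pow_mult)
    also have "\<dots> = j [^]\<^bsub>G\<^esub> (- \<beta> \<one>\<^bsub>fun_group d L\<^esub>)"
    proof (rule int_pow_cong_mod [OF j])
      have "(a * rhs L i - \<beta> s) mod int d = (a * rhs L i - (a * rhs L i + \<beta> \<one>\<^bsub>fun_group d L\<^esub>)) mod int d"
        using lift_row [OF 2(1), of a] unfolding 2(2) [symmetric] by (rule mod_diff_cong [OF HOL.refl])
      then show "(a * rhs L i + - \<beta> s) mod int d = (- \<beta> \<one>\<^bsub>fun_group d L\<^esub>) mod int d"
        by (simp del: one_product_group)
    qed
    finally show ?thesis by (simp only: True None)
  qed
qed

lemma operator_solution_twist:
  assumes "group G" "simplexwise_hom d L G j T"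
  shows "operator_solution d L\<^sub>X G j (twist G j T)"
proof -
  interpret group G by fact
  note TD = simplexwise_homD [OF assms(2)] and E = twist_edge [OF assms]
  have "twist G j T (edge d L s) \<in> carrier G \<and>
      twist G j T (edge d L s) [^]\<^bsub>G\<^esub> int d = \<one>\<^bsub>G\<^esub> \<and>
      j \<otimes>\<^bsub>G\<^esub> twist G j T (edge d L s) = twist G j T (edge d L s) \<otimes>\<^bsub>G\<^esub> j"
    if "[s] \<in> simp (N_complex d L) 1" for s
    unfolding E [OF that]
    by (intro conjI twist_properties [where d = d] TD(3,4) that TD(1,2) simplexwise_hom_exponent [OF assms])
  moreover have mult: "twist G j T (edge d L s) \<otimes>\<^bsub>G\<^esub> twist G j T (edge d L t)
      = T (s \<otimes>\<^bsub>fun_group d L\<^esub> t) \<otimes>\<^bsub>G\<^esub> j [^]\<^bsub>G\<^esub> (- \<beta> s + - \<beta> t)"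
    if "[s, t] \<in> simp (N_complex d L) 2" for s t
  proof -
    have "[s] \<in> simp (N_complex d L) 1" "[t] \<in> simp (N_complex d L) 1"
      using that complex_of_mono [OF _ Un_upper1] complex_of_mono [OF _ Un_upper2]
      unfolding simp_N_complex_1 simp_N_complex_2 by blast+
    then show ?thesis
      using TD(1,3,4) TD(5) [OF that] by (simp only: E twist_mult)
  qed
  moreover have "twist G j T (edge d L p) \<otimes>\<^bsub>G\<^esub> twist G j T (edge d L q)
      = twist G j T (edge d L q) \<otimes>\<^bsub>G\<^esub> twist G j T (edge d L p)"
    if "[s, t] \<in> simp (N_complex d L) 2" "p \<in> {s, t, s \<otimes>\<^bsub>fun_group d L\<^esub> t}"
      "q \<in> {s, t, s \<otimes>\<^bsub>fun_group d L\<^esub> t}" for s t p q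
  proof -
    have st: "s \<in> carrier (fun_group d L)" "t \<in> carrier (fun_group d L)"
      "fun_supp L s \<union> fun_supp L t \<in> complex_of L"
      using that(1) by (simp_all only: simp_N_complex_2)
    have *: "x \<in> carrier (fun_group d L) \<and> fun_supp L x \<subseteq> fun_supp L s \<union> fun_supp L t"
      if "x \<in> {s, t, s \<otimes>\<^bsub>fun_group d L\<^esub> t}" for x
      using that fun_group_mult_closed [OF st(1,2)] fun_supp_mult [where L = L and s = s and d = d and t = t] st(1,2) by blast
    have "[p, q] \<in> simp (N_complex d L) 2" "[q, p] \<in> simp (N_complex d L) 2"
      using * [OF that(2)] * [OF that(3)] st(3) by (blast intro: simp_N_complex_2I)+
    then show ?thesis by (simp only: mult fun_group_comm add.commute)
  qed
  moreover have "twist G j T (edge d L s) \<otimes>\<^bsub>G\<^esub> twist G j T (edge d L t)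
      = j [^]\<^bsub>G\<^esub> (- \<gamma> (triangle d L s t)) \<otimes>\<^bsub>G\<^esub> twist G j T (edge d L (s \<otimes>\<^bsub>fun_group d L\<^esub> t))"
    if N: "[s, t] \<in> simp (N_complex d L) 2" for s t
  proof -
    let ?st = "s \<otimes>\<^bsub>fun_group d L\<^esub> t" and ?g = "\<gamma> (triangle d L s t)"
    have st: "[?st] \<in> simp (N_complex d L) 1"
      using N fun_group_mult_closed simp_N_complex_1I [OF _ fun_supp_mult]
      unfolding simp_N_complex_2 by blast
    have "(\<beta> s + \<beta> t) mod int d = (?g + \<beta> ?st) mod int d"
      using mod_add_cong [OF lift [OF N] HOL.refl, of "\<beta> ?st"] by (simp del: mult_product_group)
    then have "(- (\<beta> s + \<beta> t)) mod int d = (- (?g + \<beta> ?st)) mod int d"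
      by (rule mod_minus_cong)
    then have "j [^]\<^bsub>G\<^esub> (- \<beta> s + - \<beta> t) = j [^]\<^bsub>G\<^esub> (- ?g + - \<beta> ?st)"
      by (intro int_pow_cong_mod [OF TD(1,2)]) (simp del: mult_product_group)
    also have "T ?st \<otimes>\<^bsub>G\<^esub> \<dots> = T ?st \<otimes>\<^bsub>G\<^esub> (j [^]\<^bsub>G\<^esub> (- ?g) \<otimes>\<^bsub>G\<^esub> j [^]\<^bsub>G\<^esub> (- \<beta> ?st))"
      using TD(1) by (simp only: int_pow_mult)
    also have "\<dots> = (j [^]\<^bsub>G\<^esub> (- ?g) \<otimes>\<^bsub>G\<^esub> T ?st) \<otimes>\<^bsub>G\<^esub> j [^]\<^bsub>G\<^esub> (- \<beta> ?st)"
      using TD(1) TD(3) [OF st] int_pow_commute [OF TD(1) TD(3) [OF st] TD(4) [OF st], of "- ?g"]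
      by (simp only: m_assoc [symmetric] int_pow_closed)
    finally show ?thesis
      unfolding mult [OF N] E [OF st] using TD(1) TD(3) [OF st]
      by (simp only: m_assoc int_pow_closed)
  qed
  ultimately show ?thesis
    unfolding operator_solution_N_bar [OF assms(1)] using TD(1,2) by blast
qed

text \<open>The row relation \<open>T(A\<^sub>i) = j [^] b\<^sub>i\<close> comes from the collapse: \<open>y\<close> takes the same value at \<open>A\<^sub>i\<close> as at
  the zero function, where \<open>T\<close> is trivial, and \<open>\<beta>\<close> differs by \<open>b\<^sub>i\<close> between the two.\<close>

lemma simplexwise_hom_untwist:
  assumes "group G" "operator_solution d L\<^sub>X G j y"
  shows "simplexwise_hom d L G j (untwist G j y)"
proof -
  interpret group G by fact
  note sol = assms(2) [unfolded operator_solution_N_bar [OF assms(1)]]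
  have j: "j \<in> carrier G" "j [^]\<^bsub>G\<^esub> int d = \<one>\<^bsub>G\<^esub>" using sol by blast+
  have y: "y (edge d L s) \<in> carrier G" "y (edge d L s) [^]\<^bsub>G\<^esub> int d = \<one>\<^bsub>G\<^esub>"
    "j \<otimes>\<^bsub>G\<^esub> y (edge d L s) = y (edge d L s) \<otimes>\<^bsub>G\<^esub> j"
    if "[s] \<in> simp (N_complex d L) 1" for s using sol that by blast+
  have tri: "y (edge d L s) \<otimes>\<^bsub>G\<^esub> y (edge d L t)
      = j [^]\<^bsub>G\<^esub> (- \<gamma> (triangle d L s t)) \<otimes>\<^bsub>G\<^esub> y (edge d L (s \<otimes>\<^bsub>fun_group d L\<^esub> t))"
    if "[s, t] \<in> simp (N_complex d L) 2" for s t using sol that by blast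
  have mult: "untwist G j y s \<otimes>\<^bsub>G\<^esub> untwist G j y t = untwist G j y (s \<otimes>\<^bsub>fun_group d L\<^esub> t)"
    if N: "[s, t] \<in> simp (N_complex d L) 2" for s t
  proof -
    let ?st = "s \<otimes>\<^bsub>fun_group d L\<^esub> t" and ?g = "\<gamma> (triangle d L s t)"
    have s: "[s] \<in> simp (N_complex d L) 1" and t: "[t] \<in> simp (N_complex d L) 1"
      using N complex_of_mono [OF _ Un_upper1] complex_of_mono [OF _ Un_upper2]
      unfolding simp_N_complex_1 simp_N_complex_2 by blast+
    have st: "[?st] \<in> simp (N_complex d L) 1"
      using N fun_group_mult_closed simp_N_complex_1I [OF _ fun_supp_mult]
      unfolding simp_N_complex_2 by blast
    have "untwist G j y s \<otimes>\<^bsub>G\<^esub> untwist G j y t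
        = (j [^]\<^bsub>G\<^esub> (- ?g) \<otimes>\<^bsub>G\<^esub> y (edge d L ?st)) \<otimes>\<^bsub>G\<^esub> j [^]\<^bsub>G\<^esub> (\<beta> s + \<beta> t)"
      unfolding untwist_def twist_mult [OF y(1) [OF s] y(1) [OF t] j(1) y(3) [OF t]] tri [OF N] ..
    also have "\<dots> = y (edge d L ?st) \<otimes>\<^bsub>G\<^esub> (j [^]\<^bsub>G\<^esub> (- ?g) \<otimes>\<^bsub>G\<^esub> j [^]\<^bsub>G\<^esub> (\<beta> s + \<beta> t))"
      using j y(1) [OF st] int_pow_commute [OF j(1) y(1) [OF st] y(3) [OF st], of "- ?g"]
      by (simp only: m_assoc int_pow_closed)
    also have "\<dots> = y (edge d L ?st) \<otimes>\<^bsub>G\<^esub> j [^]\<^bsub>G\<^esub> (- ?g + (\<beta> s + \<beta> t))"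
      using j by (simp only: int_pow_mult)
    also have "j [^]\<^bsub>G\<^esub> (- ?g + (\<beta> s + \<beta> t)) = j [^]\<^bsub>G\<^esub> \<beta> ?st"
    proof (rule int_pow_cong_mod [OF j])
      have "((\<beta> s + \<beta> t) - ?g) mod int d = ((\<beta> s + \<beta> t) - (\<beta> s + \<beta> t - \<beta> ?st)) mod int d"
        using lift [OF N] by (rule mod_diff_cong [OF HOL.refl])
      then show "(- ?g + (\<beta> s + \<beta> t)) mod int d = \<beta> ?st mod int d"
        by (simp del: mult_product_group)
    qed
    finally show ?thesis by (simp only: untwist_def)
  qed
  have one: "untwist G j y \<one>\<^bsub>fun_group d L\<^esub> = \<one>\<^bsub>G\<^esub>"
  proof -
    let ?e = "\<one>\<^bsub>fun_group d L\<^esub>"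
    have "?e \<otimes>\<^bsub>fun_group d L\<^esub> ?e = ?e"
      by (rule monoid.l_one [OF group.is_monoid [OF group_fun_group] fun_group_one_closed])
    then have "untwist G j y ?e \<otimes>\<^bsub>G\<^esub> untwist G j y ?e = untwist G j y ?e"
      using mult [OF unit_simp_N_complex(2)] by (simp only:)
    moreover have "untwist G j y ?e \<in> carrier G"
      unfolding untwist_def using y(1) [OF unit_simp_N_complex(1)] j(1) by (intro m_closed int_pow_closed)
    ultimately show ?thesis by (metis l_cancel_one)
  qed
  have row: "untwist G j y (row L i) = j [^]\<^bsub>G\<^esub> rhs L i" if i: "i \<in> rows L" for i
  proof -
    let ?e = "\<one>\<^bsub>fun_group d L\<^esub>"
    have row1: "row L i [^]\<^bsub>fun_group d L\<^esub> (1 :: int) = row L i"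
      by (rule group.int_pow_1 [OF group_fun_group row_in_fun_group [OF lin i]])
    then have "edge d L (row L i) = edge d L ?e"
      using edge_eq_None_iff [OF lin, of "row L i"] i edge_unit by metis
    then have "untwist G j y (row L i)
        = y (edge d L ?e) \<otimes>\<^bsub>G\<^esub> j [^]\<^bsub>G\<^esub> \<beta> (row L i)" by (simp only: untwist_def)
    also have "j [^]\<^bsub>G\<^esub> \<beta> (row L i) = j [^]\<^bsub>G\<^esub> (\<beta> ?e + rhs L i)"
      using lift_row [OF i, of 1] unfolding row1
      by (intro int_pow_cong_mod [OF j]) (simp add: add.commute del: one_product_group)
    also have "\<dots> = j [^]\<^bsub>G\<^esub> \<beta> ?e \<otimes>\<^bsub>G\<^esub> j [^]\<^bsub>G\<^esub> rhs L i"
      using j by (simp only: int_pow_mult)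
    also have "y (edge d L ?e) \<otimes>\<^bsub>G\<^esub> \<dots> = untwist G j y ?e \<otimes>\<^bsub>G\<^esub> j [^]\<^bsub>G\<^esub> rhs L i"
      unfolding untwist_def using y(1) [OF unit_simp_N_complex(1)] j
      by (simp only: m_assoc int_pow_closed)
    finally show ?thesis using j by (simp only: one l_one int_pow_closed)
  qed
  have "untwist G j y s \<in> carrier G \<and> j \<otimes>\<^bsub>G\<^esub> untwist G j y s = untwist G j y s \<otimes>\<^bsub>G\<^esub> j"
    if "[s] \<in> simp (N_complex d L) 1" for s
    unfolding untwist_def
    by (intro conjI twist_properties(1,2) [OF y(1) [OF that] j(1) y(3) [OF that] y(2) [OF that] j(2)])
  with j mult row show ?thesis
    unfolding simplexwise_hom_def by blast
qed

text \<open>The map \<open>S\<close> comes from the universal solution of \<open>(A, b)\<close> and \<open>T\<close> from that of \<open>(A\<^sub>X, b\<^sub>\<gamma>)\<close>. The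
  homomorphisms between the solution groups carry \<open>S\<close> and \<open>T\<close> into each other, because the
  constructions only use products and powers; so they are inverse to each other.\<close>

lemma solution_group_iso: "solution_group d L \<cong> solution_group d L\<^sub>X"
proof -
  let ?G = "solution_group d L" and ?H = "solution_group d L\<^sub>X"
  let ?j = "sol_class d L J" and ?j' = "sol_class d L\<^sub>X J"
  let ?e = "\<lambda>v. sol_class d L (E v)" and ?y = "\<lambda>x. sol_class d L\<^sub>X (E x)"
  have d0: "0 < d" using d by simp
  have linX: "linear_system d L\<^sub>X"
    by (rule linear_system_system_of [OF simplicial_set_N_bar d0])
  interpret G: group ?G by (rule group_solution_group)
  interpret H: group ?H by (rule group_solution_group)
  have solG: "operator_solution d L ?G ?j ?e"
    by (rule operator_solution_solution_group [OF lin d0])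
  have solH: "operator_solution d L\<^sub>X ?H ?j' ?y"
    by (rule operator_solution_solution_group [OF linX d0])
  define S where "S = extend_solution L ?G ?e"
  define T where "T = untwist ?H ?j' ?y"
  have S: "simplexwise_hom d L ?G ?j S"
    unfolding S_def by (rule simplexwise_hom_extend_solution [OF G.group_axioms lin solG])
  have T: "simplexwise_hom d L ?H ?j' T"
    unfolding T_def by (rule simplexwise_hom_untwist [OF H.group_axioms solH])
  show ?thesis
  proof (rule solution_groups_isoI [OF lin linX d0])
    show "operator_solution d L ?H ?j' (\<lambda>v. T (unit_fun L v))"
      by (rule operator_solution_of_simplexwise_hom [OF H.group_axioms T d lin])
    show "operator_solution d L\<^sub>X ?G ?j (twist ?G ?j S)"
      by (rule operator_solution_twist [OF G.group_axioms S])
  next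
    fix h x
    assume h: "h \<in> hom ?G ?H" "h ?j = ?j'" "\<And>v. v \<in> cols L \<Longrightarrow> h (?e v) = T (unit_fun L v)"
      and "x \<in> cols L\<^sub>X"
    then obtain s where s: "x = edge d L s" "[s] \<in> simp (N_complex d L) 1"
      by (auto simp: system_of_def simp_N_bar_1 simp del: One_nat_def)
    have sK: "fun_supp L s \<in> complex_of L" using s(2) by (simp only: simp_N_complex_1)
    obtain vs where vs: "distinct vs" "set vs = fun_supp L s"
      using finite_distinct_list [OF finite_complex_of [OF lin sK]] by blast
    have vsc: "v \<in> cols L" if "v \<in> set vs" for v using that vs(2) by (auto simp: fun_supp_def)
    interpret h: group_hom ?G ?H h by unfold_locales (rule h(1))
    have "h (S s) = h (row_product ?G ?e s vs)"
      unfolding S_def by (simp only: extend_solution_eq_row_product [OF G.group_axioms lin solG sK vs])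
    also have "\<dots> = row_product ?H (\<lambda>v. h (?e v)) s vs"
      by (rule hom_row_product [OF h(1) G.group_axioms H.group_axioms])
        (rule operator_solutionD(3) [OF solG vsc])
    also have "\<dots> = row_product ?H (\<lambda>v. T (unit_fun L v)) s vs"
      unfolding row_product_def
      by (rule arg_cong [where f = "list_prod ?H"], rule map_cong) (simp_all add: h(3) vsc)
    also have "\<dots> = T s"
      by (rule simplexwise_hom_eq_row_product [OF H.group_axioms T d s(2) vs, symmetric])
    finally have hS: "h (S s) = T s" .
    note SD = simplexwise_homD [OF S] and TD = simplexwise_homD [OF T]
    have "h (twist ?G ?j S x) = T s \<otimes>\<^bsub>?H\<^esub> ?j' [^]\<^bsub>?H\<^esub> (- \<beta> s)"
      unfolding s(1) twist_edge [OF G.group_axioms S s(2)]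
      using SD(1) SD(3) [OF s(2)] by (simp only: h.hom_mult h.hom_int_pow G.int_pow_closed hS h(2))
    also have "\<dots> = ?y x \<otimes>\<^bsub>?H\<^esub> (?j' [^]\<^bsub>?H\<^esub> \<beta> s \<otimes>\<^bsub>?H\<^esub> ?j' [^]\<^bsub>?H\<^esub> (- \<beta> s))"
      unfolding T_def untwist_def s(1)
      by (rule H.m_assoc) (use TD(1) operator_solutionD(3) [OF solH \<open>x \<in> cols L\<^sub>X\<close>] s(1) in simp_all)
    also have "\<dots> = ?y x"
      using TD(1) operator_solutionD(3) [OF solH \<open>x \<in> cols L\<^sub>X\<close>]
      by (simp add: H.int_pow_mult [symmetric])
    finally show "h (twist ?G ?j S x) = ?y x" .
  next
    fix k v
    assume k: "k \<in> hom ?H ?G" "k ?j' = ?j" "\<And>x. x \<in> cols L\<^sub>X \<Longrightarrow> k (?y x) = twist ?G ?j S x"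
      and v: "v \<in> cols L"
    let ?u = "unit_fun L v"
    interpret k: group_hom ?H ?G k by unfold_locales (rule k(1))
    have u: "[?u] \<in> simp (N_complex d L) 1" by (rule unit_fun_simp [OF d v])
    then have x: "edge d L ?u \<in> cols L\<^sub>X"
      by (auto simp: system_of_def simp_N_bar_1 simp del: One_nat_def)
    note SD = simplexwise_homD [OF S] and TD = simplexwise_homD [OF T]
    have "k (T ?u) = twist ?G ?j S (edge d L ?u) \<otimes>\<^bsub>?G\<^esub> ?j [^]\<^bsub>?G\<^esub> \<beta> ?u"
      unfolding T_def untwist_def
      using TD(1) operator_solutionD(3) [OF solH x]
      by (simp only: k.hom_mult k.hom_int_pow H.int_pow_closed k(2) k(3) [OF x])
    also have "\<dots> = S ?u \<otimes>\<^bsub>?G\<^esub> (?j [^]\<^bsub>?G\<^esub> (- \<beta> ?u) \<otimes>\<^bsub>?G\<^esub> ?j [^]\<^bsub>?G\<^esub> \<beta> ?u)"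
      unfolding twist_edge [OF G.group_axioms S u] using SD(1) SD(3) [OF u]
      by (simp only: G.m_assoc G.int_pow_closed)
    also have "\<dots> = S ?u"
      using SD(1) SD(3) [OF u] by (simp add: G.int_pow_mult [symmetric])
    also have "\<dots> = ?e v"
      unfolding S_def by (rule extend_solution_unit_fun [OF G.group_axioms lin solG v])
    finally show "k (T ?u) = ?e v" .
  qed
qed

end

theorem proposition2p18:
  fixes d :: nat
    and L :: "('r, 'c) lin_sys"
    and \<gamma> :: "('c \<Rightarrow> int) list option \<Rightarrow> int"
  assumes "1 < d"
    and "linear_system d L"
    and "standing_assumptions d L"
    and "\<gamma> \<in> cocycles d (N_bar d L) 2"
    and "cohomology_class d (N_bar d L) 2 \<gamma> = cohomology_class d (N_bar d L) 2 (gamma_b d L)"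
  shows "solution_group d L \<cong> solution_group d (system_of d (N_bar d L) \<gamma>)"
proof -
  have "0 < d" using assms(1) by simp
  from cocycle_lift [OF assms(2,3) this assms(4,5)] obtain \<beta> where \<beta>:
    "\<And>s t. [s, t] \<in> simp (N_complex d L) 2 \<Longrightarrow> \<gamma> (triangle d L s t) mod int d
      = (\<beta> s + \<beta> t - \<beta> (s \<otimes>\<^bsub>fun_group d L\<^esub> t)) mod int d"
    "\<And>i a. i \<in> rows L \<Longrightarrow> \<beta> (row L i [^]\<^bsub>fun_group d L\<^esub> (a :: int)) mod int d
      = (a * rhs L i + \<beta> \<one>\<^bsub>fun_group d L\<^esub>) mod int d"
    by blast
  interpret lifted_cocycle d L \<gamma> \<beta>
    by unfold_locales (fact assms(1), fact assms(2), erule \<beta>(1), erule \<beta>(2))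
  show ?thesis by (rule solution_group_iso)
qed

end
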